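(* Let $S$ be a left cancellative monoid with neutral element $e$, $\mathbb{F}$ a field of characteristic $p$, and $A$ an associative $\mathbb{F}$-algebra with an $S$-grading $\Gamma: A=\bigoplus_{g\in S}A_g$ of finite support; put $d=|\mathrm{Supp}(\Gamma)|$. Suppose $A_e$ is a nil algebra of bounded index with $s=\mathrm{nd}_{nil}(A_e)>1$. If $p=0$ or $p>s$, then $A$ is a nilpotent algebra. In addition: (i) if $p>s$, then $\mathrm{nd}(A)\leq d(2^s-1)$; (ii) if $p=0$, then $\mathrm{nd}(A)\leq dq$, where $q=2^s-1$ if $s\in\{2,3,4\}$ and $q=s^2$ if $s\geq 5$. If instead $\mathrm{nd}(A_e)=1$, then $A$ is nilpotent for any field $\mathbb{F}$, and $\mathrm{nd}(A)\leq d+1$.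
   Context: Algebras are associative, not necessarily with unity. A monoid $S$ is left cancellative if $gh=gt$ implies $h=t$ for all $g,h,t\in S$. An $S$-grading on the algebra $A$ is a decomposition $\Gamma: A=\bigoplus_{g\in S}A_g$ into $\mathbb{F}$-subspaces with $A_gA_h\subseteq A_{gh}$ for all $g,h\in S$; its support is $\mathrm{Supp}(\Gamma)=\{g\in S: A_g\neq 0\}$. An algebra $B$ is nil of bounded index if there is a single $n>0$ with $b^n=0$ for all $b\in B$; $\mathrm{nd}_{nil}(B)$ denotes the smallest such $n$. $B$ is nilpotent if for some $n>0$ one has $a_1\cdots a_n=0$ for all $a_1,\dots,a_n\in B$; the nilpotency index $\mathrm{nd}(B)$ is the smallest such positive integer $n$ (so $\mathrm{nd}(B)=1$ iff $B=\{0\}$). *)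

theory Defs
  imports "HOL-Computational_Algebra.Computational_Algebra"
begin

text \<open>Class \<open>ring\<close> has no unit, so this is the not necessarily unital notion; the algebra is the
  whole type \<open>'a\<close>.\<close>

locale assoc_algebra = vector_space scale
  for scale :: "'f::field \<Rightarrow> 'a::ring \<Rightarrow> 'a" (infixr \<open>*s\<close> 75) +
  assumes scale_mult_left: "(c *s x) * y = c *s (x * y)"
    and scale_mult_right: "x * (c *s y) = c *s (x * y)"

definition Supp :: "('s \<Rightarrow> 'a::zero set) \<Rightarrow> 's set" where
  "Supp \<Gamma> = {g. \<Gamma> g \<noteq> {0}}"

locale graded_algebra = assoc_algebra scale
  for scale :: "'f::field \<Rightarrow> 'a::ring \<Rightarrow> 'a" (infixr \<open>*s\<close> 75) +
  fixes \<Gamma> :: "'s::monoid_mult \<Rightarrow> 'a set"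
  assumes subspace_component: "subspace (\<Gamma> g)"
    and direct_sum:
      "\<exists>!x. (\<forall>g. x g \<in> \<Gamma> g) \<and> finite {g. x g \<noteq> 0} \<and> a = (\<Sum>g | x g \<noteq> 0. x g)"
    and component_mult: "x \<in> \<Gamma> g \<Longrightarrow> y \<in> \<Gamma> h \<Longrightarrow> x * y \<in> \<Gamma> (g * h)"

text \<open>Without a unit there is no empty product: the product of \<open>[a\<^sub>1, \<dots>, a\<^sub>n]\<close> is meaningful only
  for \<open>n > 0\<close>, and likewise the power \<open>b\<^sup>n\<close> below.\<close>

definition list_mult :: "'a::semigroup_mult list \<Rightarrow> 'a" where
  "list_mult xs = foldl (*) (hd xs) (tl xs)"

definition pos_power :: "'a::semigroup_mult \<Rightarrow> nat \<Rightarrow> 'a" where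
  "pos_power b n = list_mult (replicate n b)"

definition nil_index_bound :: "'a::ring set \<Rightarrow> nat \<Rightarrow> bool" where
  "nil_index_bound B n \<longleftrightarrow> n > 0 \<and> (\<forall>b\<in>B. pos_power b n = 0)"

definition nil_bounded_index :: "'a::ring set \<Rightarrow> bool" where
  "nil_bounded_index B \<longleftrightarrow> (\<exists>n. nil_index_bound B n)"

text \<open>\<open>nd_nil B\<close> and \<open>nd B\<close> are unspecified unless \<open>B\<close> is nil of bounded index, respectively
  nilpotent.\<close>

definition nd_nil :: "'a::ring set \<Rightarrow> nat" where
  "nd_nil B = (LEAST n. nil_index_bound B n)"

definition nilpotency_bound :: "'a::ring set \<Rightarrow> nat \<Rightarrow> bool" where
  "nilpotency_bound B n \<longleftrightarrow>
     n > 0 \<and> (\<forall>as. length as = n \<and> set as \<subseteq> B \<longrightarrow> list_mult as = 0)"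

definition nilpotent_algebra :: "'a::ring set \<Rightarrow> bool" where
  "nilpotent_algebra B \<longleftrightarrow> (\<exists>n. nilpotency_bound B n)"

definition nd :: "'a::ring set \<Rightarrow> nat" where
  "nd B = (LEAST n. nilpotency_bound B n)"

end

theory Submission
  imports Defs "HOL-Combinatorics.Combinatorics"
begin

text \<open>
  The degrees of the initial segments of a product of homogeneous elements lie in the support, so a
  long product has many initial segments of the same degree; by left cancellation the factors
  between them multiply to elements of the neutral component. Hence everything reduces to the
  nilpotency of a nil algebra of index \<open>n\<close>.

  The bound \<open>2\<^sup>n - 1\<close> (Nagata--Higman) follows by induction from
  \<open>x\<^bsup>n - 1\<^esup> z y\<^bsup>n - 1\<^esup> = 0\<close>.

  The bound \<open>n\<^sup>2\<close> in characteristic 0 (Razmyslov): let \<open>N = n\<^sup>2 + 1\<close> and send a full cycle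
  \<open>(0 i\<^sub>1 \<dots> i\<^sub>m)\<close> in \<open>S\<^sub>N\<close> to \<open>a\<^bsub>i\<^sub>1\<^esub> \<cdots> a\<^bsub>i\<^sub>m\<^esub>\<close> and every other permutation to 0. On each coset of
  the symmetric group of an \<open>(n + 1)\<close>-element set, the values add up to a linearization of
  \<open>x\<^sup>n = 0\<close>, and since full cycles have equal signs, this holds with and without signs. The symmetrizers
  and antisymmetrizers on \<open>n + 1\<close> points generate the rational group algebra of \<open>S\<^sub>N\<close> as an ideal, so all
  values vanish. This generation is proved without representation theory: functions killed by the
  antisymmetrizers are spanned by the indicators of \<open>{\<pi>. c \<circ> \<pi> = c'}\<close> for colourings with \<open>n\<close>
  colours, and functions killed by the symmetrizers are orthogonal to these indicators.
\<close>

subsection \<open>Symmetrizers and antisymmetrizers\<close>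

definition lex_less :: "nat \<Rightarrow> (nat \<Rightarrow> nat) \<Rightarrow> (nat \<Rightarrow> nat) \<Rightarrow> bool" where
  "lex_less N \<pi> \<rho> \<longleftrightarrow> (\<exists>i<N. (\<forall>j<i. \<pi> j = \<rho> j) \<and> \<pi> i < \<rho> i)"

text \<open>Only the first \<open>N\<close> values are compared, so the relation is pulled back from
  the lexicographic order on words of equal length, which is well-founded although the letters are
  arbitrary natural numbers.\<close>

lemma wfp_lex_less: "wfp (lex_less N)"
proof -
  have "(map \<pi> [0..<N], map \<rho> [0..<N]) \<in> lex less_than" if lt: "lex_less N \<pi> \<rho>" for \<pi> \<rho>
  proof -
    obtain i where i: "i < N" "\<forall>j<i. \<pi> j = \<rho> j" "\<pi> i < \<rho> i"
      using lt by (auto simp: lex_less_def)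
    have split: "[0..<N] = [0..<i] @ i # [Suc i..<N]"
      using i(1) upt_add_eq_append[of 0 i "N - i"] upt_conv_Cons[of i N] by simp
    have "map \<pi> [0..<i] = map \<rho> [0..<i]"
      using i(2) by simp
    with i(3) show ?thesis
      unfolding lex_conv mem_Collect_eq split_conv
      by (intro conjI exI[of _ "map \<rho> [0..<i]"] exI[of _ "\<pi> i"] exI[of _ "\<rho> i"]
          exI[of _ "map \<pi> [Suc i..<N]"] exI[of _ "map \<rho> [Suc i..<N]"]) (simp_all add: split)
  qed
  then have "{(\<pi>, \<rho>). lex_less N \<pi> \<rho>} \<subseteq> inv_image (lex less_than) (\<lambda>\<pi>. map \<pi> [0..<N])"
    by auto
  then have "wf {(\<pi>, \<rho>). lex_less N \<pi> \<rho>}"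
    using wf_inv_image[OF wf_lex[OF wf_less_than]] wf_subset by blast
  then show ?thesis
    by (simp add: wfp_def)
qed

lemma permutes_first_difference:
  fixes \<pi> \<rho> :: "nat \<Rightarrow> nat"
  assumes "\<pi> permutes {..<N}" "\<rho> permutes {..<N}" "\<pi> \<noteq> \<rho>"
  obtains i where "i < N" "\<forall>j<i. \<pi> j = \<rho> j" "\<pi> i \<noteq> \<rho> i"
proof -
  obtain k where k: "\<pi> k \<noteq> \<rho> k"
    using assms(3) by blast
  define i where "i = (LEAST k. \<pi> k \<noteq> \<rho> k)"
  have i: "\<pi> i \<noteq> \<rho> i" "\<forall>j<i. \<pi> j = \<rho> j"
    using LeastI[of "\<lambda>k. \<pi> k \<noteq> \<rho> k", OF k] not_less_Least[of _ "\<lambda>k. \<pi> k \<noteq> \<rho> k"]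
    unfolding i_def by blast+
  moreover have "i < N"
    using i(1) permutes_not_in[OF assms(1)] permutes_not_in[OF assms(2)]
    by (metis lessThan_iff)
  ultimately show thesis
    using that by blast
qed

section \<open>Functions on the symmetric group, decreasing subsequences and colourings\<close>

definition has_decreasing :: "nat \<Rightarrow> nat \<Rightarrow> (nat \<Rightarrow> nat) \<Rightarrow> bool" where
  "has_decreasing N k \<pi> \<longleftrightarrow>
     (\<exists>S\<subseteq>{..<N}. card S = k \<and> (\<forall>i\<in>S. \<forall>j\<in>S. i < j \<longrightarrow> \<pi> j < \<pi> i))"

text \<open>\<open>X\<close> is a set of values and \<open>\<tau>\<close> acts on the left, so each
  sum runs over a right coset of the symmetric group of \<open>X\<close>. Extended linearly to the
  group algebra, \<open>f\<close> vanishes on the ideal generated by the antisymmetrizers on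
  \<open>k\<close> points.\<close>

definition killed_by_antisymmetrizers :: "nat \<Rightarrow> nat \<Rightarrow> ((nat \<Rightarrow> nat) \<Rightarrow> 'c::comm_ring_1) \<Rightarrow> bool" where
  "killed_by_antisymmetrizers N k f \<longleftrightarrow>
     (\<forall>X \<pi>. X \<subseteq> {..<N} \<and> card X = k \<and> \<pi> permutes {..<N} \<longrightarrow>
        (\<Sum>\<tau> | \<tau> permutes X. of_int (sign \<tau>) * f (\<tau> \<circ> \<pi>)) = 0)"

definition killed_by_symmetrizers :: "nat \<Rightarrow> nat \<Rightarrow> ((nat \<Rightarrow> nat) \<Rightarrow> 'c::comm_ring_1) \<Rightarrow> bool" where
  "killed_by_symmetrizers N k f \<longleftrightarrow>
     (\<forall>X \<pi>. X \<subseteq> {..<N} \<and> card X = k \<and> \<pi> permutes {..<N} \<longrightarrow>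
        (\<Sum>\<tau> | \<tau> permutes X. f (\<tau> \<circ> \<pi>)) = 0)"

text \<open>Here \<open>c\<close> colours values and \<open>c'\<close> colours positions. On
  permutations of \<open>{..<N}\<close> this is the indicator of a right coset of the Young subgroup
  preserving \<open>c\<close>, or zero if the colour classes differ in size.\<close>

definition colour_indicator ::
    "nat \<Rightarrow> (nat \<Rightarrow> nat) \<Rightarrow> (nat \<Rightarrow> nat) \<Rightarrow> (nat \<Rightarrow> nat) \<Rightarrow> 'c::comm_ring_1" where
  "colour_indicator N c c' \<pi> = of_bool (\<forall>i<N. c (\<pi> i) = c' i)"

lemma colour_indicator_compose:
  assumes "\<And>x. c (\<tau> x) = c x"
  shows "colour_indicator N c c' (\<tau> \<circ> \<pi>) = colour_indicator N c c' \<pi>"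
  using assms by (simp add: colour_indicator_def)

text \<open>Along \<open>S\<close> the values of \<open>\<pi>\<close> come in the greatest possible
  order. At the first changed position \<open>i\<close> the new value is \<open>\<pi> j\<close> with
  \<open>j\<close> in \<open>S\<close>; an earlier \<open>j\<close> is excluded because its value is
  already used, so \<open>j\<close> is later and \<open>\<pi> j\<close> smaller.\<close>

lemma decreasing_lex_greatest:
  assumes \<pi>: "\<pi> permutes {..<N}"
    and S: "S \<subseteq> {..<N}" "\<forall>i\<in>S. \<forall>j\<in>S. i < j \<longrightarrow> \<pi> j < \<pi> i"
    and \<tau>: "\<tau> permutes \<pi> ` S" "\<tau> \<noteq> id"
  shows "lex_less N (\<tau> \<circ> \<pi>) \<pi>"
proof -
  have sub: "\<pi> ` S \<subseteq> {..<N}"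
    using S(1) permutes_image[OF \<pi>] by blast
  have \<tau>\<pi>: "\<tau> \<circ> \<pi> permutes {..<N}"
    using \<pi> permutes_subset[OF \<tau>(1) sub] by (rule permutes_compose)
  have "\<tau> \<circ> \<pi> \<noteq> \<pi>"
  proof
    assume "\<tau> \<circ> \<pi> = \<pi>"
    then have "\<tau> (\<pi> (inv \<pi> x)) = \<pi> (inv \<pi> x)" for x
      by (simp add: fun_eq_iff)
    with \<tau>(2) show False
      by (simp add: permutes_inverses(1)[OF \<pi>] fun_eq_iff)
  qed
  then obtain i where i: "i < N" "\<forall>j<i. (\<tau> \<circ> \<pi>) j = \<pi> j" "(\<tau> \<circ> \<pi>) i \<noteq> \<pi> i"
    using permutes_first_difference[OF \<tau>\<pi> \<pi>] by blast
  have "\<pi> i \<in> \<pi> ` S"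
    using i(3) permutes_not_in[OF \<tau>(1)] by fastforce
  then have "i \<in> S"
    using permutes_inj[OF \<pi>] by (auto simp: inj_def)
  then have "\<tau> (\<pi> i) \<in> \<pi> ` S"
    using permutes_in_image[OF \<tau>(1)] by blast
  then obtain j where j: "j \<in> S" "\<tau> (\<pi> i) = \<pi> j"
    by blast
  have "\<not> j < i"
  proof
    assume "j < i"
    then have "\<tau> (\<pi> j) = \<tau> (\<pi> i)"
      using i(2) j(2) by simp
    then have "j = i"
      using injD[OF permutes_inj[OF \<tau>(1)]] injD[OF permutes_inj[OF \<pi>]] by blast
    with \<open>j < i\<close> show False by simp
  qed
  moreover have "j \<noteq> i"
    using i(3) j(2) by auto
  ultimately have "\<pi> j < \<pi> i"
    using S(2) \<open>i \<in> S\<close> j(1) by simp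
  with i j(2) show ?thesis
    unfolding lex_less_def by auto
qed

text \<open>The relation for the values on a decreasing subsequence expresses \<open>f \<pi>\<close>
  by values of \<open>f\<close> at lexicographically smaller permutations. Thus \<open>f\<close> is
  determined by the permutations without decreasing subsequences of length \<open>k\<close>.\<close>

lemma killed_by_antisymmetrizers_eq_0:
  fixes f :: "(nat \<Rightarrow> nat) \<Rightarrow> 'c::comm_ring_1"
  assumes f: "killed_by_antisymmetrizers N k f"
    and good: "\<And>\<pi>. \<pi> permutes {..<N} \<Longrightarrow> \<not> has_decreasing N k \<pi> \<Longrightarrow> f \<pi> = 0"
    and \<pi>: "\<pi> permutes {..<N}"
  shows "f \<pi> = 0"
  using \<pi>
proof (induction \<pi> rule: wfp_induct_rule[OF wfp_lex_less[of N]])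
  case (1 \<pi>)
  show ?case
  proof (cases "has_decreasing N k \<pi>")
    case False
    then show ?thesis using good 1 by blast
  next
    case True
    then obtain S where S: "S \<subseteq> {..<N}" "card S = k" "\<forall>i\<in>S. \<forall>j\<in>S. i < j \<longrightarrow> \<pi> j < \<pi> i"
      unfolding has_decreasing_def by blast
    define X where "X = \<pi> ` S"
    have X: "X \<subseteq> {..<N}" "card X = k"
      using S(1,2) image_mono[OF S(1), of \<pi>] permutes_image[OF 1(2)]
        card_image[OF permutes_inj_on[OF 1(2)], of S]
      unfolding X_def by simp_all
    have fin: "finite {\<tau>. \<tau> permutes X}"
      using X(1) finite_permutations finite_subset by blast
    have "0 = (\<Sum>\<tau> | \<tau> permutes X. of_int (sign \<tau>) * f (\<tau> \<circ> \<pi>))"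
      using f X 1(2) unfolding killed_by_antisymmetrizers_def by simp
    also have "\<dots> = of_int (sign (id :: nat \<Rightarrow> nat)) * f (id \<circ> \<pi>) +
        (\<Sum>\<tau>\<in>{\<tau>. \<tau> permutes X} - {id}. of_int (sign \<tau>) * f (\<tau> \<circ> \<pi>))"
      by (rule sum.remove[OF fin]) (simp add: permutes_id)
    also have "(\<Sum>\<tau>\<in>{\<tau>. \<tau> permutes X} - {id}. of_int (sign \<tau>) * f (\<tau> \<circ> \<pi>)) = 0"
    proof (rule sum.neutral, rule ballI)
      fix \<tau> assume "\<tau> \<in> {\<tau>. \<tau> permutes X} - {id}"
      then have \<tau>: "\<tau> permutes X" "\<tau> \<noteq> id" by auto
      have "lex_less N (\<tau> \<circ> \<pi>) \<pi>"
        using decreasing_lex_greatest[OF 1(2) S(1,3)] \<tau> unfolding X_def by blast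
      moreover have "\<tau> \<circ> \<pi> permutes {..<N}"
        using 1(2) permutes_subset[OF \<tau>(1) X(1)] by (rule permutes_compose)
      ultimately have "f (\<tau> \<circ> \<pi>) = 0"
        by (rule 1(1))
      then show "of_int (sign \<tau>) * f (\<tau> \<circ> \<pi>) = 0"
        by simp
    qed
    finally show ?thesis by simp
  qed
qed

lemma sum_permutes_compose_left:
  assumes "\<tau> permutes X"
  shows "(\<Sum>\<pi> | \<pi> permutes X. g (\<tau> \<circ> \<pi>)) = (\<Sum>\<pi> | \<pi> permutes X. g \<pi>)"
  by (rule sum.reindex_bij_witness[of _ "\<lambda>\<pi>. inv \<tau> \<circ> \<pi>" "\<lambda>\<pi>. \<tau> \<circ> \<pi>"])
    (use assms in \<open>auto simp: permutes_inv_o permutes_compose permutes_inv comp_assoc[symmetric]\<close>)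

text \<open>Among \<open>n + 1\<close> values two share one of the \<open>n\<close> colours.
  Composing with their transposition reverses the sign and keeps the indicator, so the sum equals
  its own negative.\<close>

lemma colour_indicator_killed_by_antisymmetrizers:
  assumes c: "c ` {..<N} \<subseteq> {..<n}"
  shows "killed_by_antisymmetrizers N (Suc n) (colour_indicator N c c' :: _ \<Rightarrow> 'c::field_char_0)"
  unfolding killed_by_antisymmetrizers_def
proof (intro allI impI, elim conjE)
  fix X \<pi> assume X: "X \<subseteq> {..<N}" "card X = Suc n" and \<pi>: "\<pi> permutes {..<N}"
  have "card (c ` X) \<le> n"
    using c X(1) card_mono[of "{..<n}" "c ` X"] by auto
  then have "\<not> inj_on c X"
    using X(2) card_image by fastforce
  then obtain x y where xy: "x \<in> X" "y \<in> X" "x \<noteq> y" "c x = c y"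
    unfolding inj_on_def by blast
  define t where "t = transpose x y"
  have t: "t permutes X"
    unfolding t_def using xy by (simp add: permutes_swap_id)
  have finX: "finite X"
    using X(1) finite_subset by blast
  have pt: "permutation t"
    unfolding t_def by (rule permutation_swap_id)
  let ?g = "\<lambda>\<tau>. of_int (sign \<tau>) * (colour_indicator N c c' (\<tau> \<circ> \<pi>) :: 'c)"
  have "(\<Sum>\<tau> | \<tau> permutes X. ?g \<tau>) = (\<Sum>\<tau> | \<tau> permutes X. ?g (t \<circ> \<tau>))"
    using sum_permutes_compose_left[OF t, of ?g] by simp
  also have "\<dots> = (\<Sum>\<tau> | \<tau> permutes X. - ?g \<tau>)"
  proof (rule sum.cong[OF refl])
    fix \<tau> assume "\<tau> \<in> {\<tau>. \<tau> permutes X}"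
    then have "permutation \<tau>"
      using finX permutation_permutes by blast
    then have "sign (t \<circ> \<tau>) = - sign \<tau>"
      using pt xy(3) by (simp add: sign_compose) (simp add: t_def sign_swap_id)
    moreover have "c (t z) = c z" for z
      using xy(4) by (simp add: t_def transpose_def)
    ultimately show "?g (t \<circ> \<tau>) = - ?g \<tau>"
      using colour_indicator_compose[of c t N c' "\<tau> \<circ> \<pi>"] by (simp add: comp_assoc)
  qed
  also have "\<dots> = - (\<Sum>\<tau> | \<tau> permutes X. ?g \<tau>)"
    by (rule sum_negf)
  finally show "(\<Sum>\<tau> | \<tau> permutes X. ?g \<tau>) = 0"
    by (simp add: eq_neg_iff_add_eq_0)
qed

lemma pigeonhole_fibre:
  assumes "finite A" "finite D" "h ` A \<subseteq> D" "card D * q < card A"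
  obtains y where "y \<in> D" "q < card {x\<in>A. h x = y}"
proof (rule ccontr)
  assume "\<not> thesis"
  with that have le: "card {x\<in>A. h x = y} \<le> q" if "y \<in> D" for y
    using \<open>y \<in> D\<close> by (meson not_le)
  have "card A = card (\<Union>y\<in>D. {x\<in>A. h x = y})"
    using assms(3) by (intro arg_cong[of _ _ card]) blast
  also have "\<dots> \<le> (\<Sum>y\<in>D. card {x\<in>A. h x = y})"
    by (rule card_UN_le[OF assms(2)])
  also have "\<dots> \<le> card D * q"
    using sum_mono[OF le, of D] by simp
  finally show False
    using assms(4) by simp
qed

text \<open>As \<open>n\<^sup>2 < N\<close>, some colour has at least \<open>n + 1\<close> values.
  The symmetric group of \<open>n + 1\<close> of them preserves the indicator, so the scalar product
  is unchanged when \<open>f\<close> is averaged over this group, and the average is 0.\<close>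

lemma symmetrizers_orthogonal_colour_indicator:
  fixes f :: "(nat \<Rightarrow> nat) \<Rightarrow> 'c::field_char_0"
  assumes f: "killed_by_symmetrizers N (Suc n) f"
    and c: "c ` {..<N} \<subseteq> {..<n}" and N: "n\<^sup>2 < N"
  shows "(\<Sum>\<pi> | \<pi> permutes {..<N}. f \<pi> * colour_indicator N c c' \<pi>) = 0"
proof -
  obtain y where y: "n < card {x\<in>{..<N}. c x = y}"
    using pigeonhole_fibre[OF _ _ c, of n] N by (auto simp: power2_eq_square)
  then obtain X where X: "X \<subseteq> {x\<in>{..<N}. c x = y}" "card X = Suc n" "finite X"
    using obtain_subset_with_card_n[of "Suc n" "{x\<in>{..<N}. c x = y}"] by (metis Suc_leI)
  let ?d = "colour_indicator N c c' :: _ \<Rightarrow> 'c"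
  let ?P = "{\<pi>. \<pi> permutes {..<N}}"
  have sub: "X \<subseteq> {..<N}"
    using X(1) by blast
  have shift: "(\<Sum>\<pi>\<in>?P. f (\<tau> \<circ> \<pi>) * ?d \<pi>) = (\<Sum>\<pi>\<in>?P. f \<pi> * ?d \<pi>)"
    if \<tau>: "\<tau> permutes X" for \<tau>
  proof -
    have "c (\<tau> x) = c x" for x
    proof (cases "x \<in> X")
      case True
      then have "\<tau> x \<in> X" using permutes_in_image[OF \<tau>] by simp
      with True X(1) show ?thesis by auto
    qed (simp add: permutes_not_in[OF \<tau>])
    then show ?thesis
      using sum_permutes_compose_left[OF permutes_subset[OF \<tau> sub], of "\<lambda>\<pi>. f \<pi> * ?d \<pi>"]
      by (simp add: colour_indicator_compose)
  qed
  have "of_nat (card {\<tau>. \<tau> permutes X}) * (\<Sum>\<pi>\<in>?P. f \<pi> * ?d \<pi>) =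
      (\<Sum>\<tau> | \<tau> permutes X. \<Sum>\<pi>\<in>?P. f (\<tau> \<circ> \<pi>) * ?d \<pi>)"
    by (simp add: shift)
  also have "\<dots> = (\<Sum>\<pi>\<in>?P. (\<Sum>\<tau> | \<tau> permutes X. f (\<tau> \<circ> \<pi>)) * ?d \<pi>)"
    by (subst sum.swap) (simp add: sum_distrib_right)
  also have "\<dots> = 0"
    using f sub X(2) unfolding killed_by_symmetrizers_def by (intro sum.neutral) auto
  finally show ?thesis
    using X(3) by (simp add: card_permutations[OF refl])
qed

text \<open>Positions are coloured by the greatest length of a decreasing subsequence ending there;
  an inversion between two positions of one colour would prolong such a subsequence.\<close>

lemma no_decreasing_colouring:
  assumes \<sigma>: "\<sigma> permutes {..<N}" and good: "\<not> has_decreasing N (Suc n) \<sigma>"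
  obtains c where "c ` {..<N} \<subseteq> {..<n}" "\<And>i j. i < j \<Longrightarrow> j < N \<Longrightarrow> c i = c j \<Longrightarrow> \<sigma> i < \<sigma> j"
proof -
  \<comment> \<open>The end point \<open>i\<close> is not counted in \<open>S\<close>. Hence the
    maxima start at 0 and stay below \<open>n\<close>, as \<open>S\<close> together with
    \<open>i\<close> has at most \<open>n\<close> elements.\<close>
  define D where "D i = {S. S \<subseteq> {..<i} \<and> (\<forall>a\<in>S. \<forall>b\<in>insert i S. a < b \<longrightarrow> \<sigma> b < \<sigma> a)}" for i
  define c where "c i = Max (card ` D i)" for i
  have fin: "finite (D i)" for i
    by (rule finite_subset[of _ "Pow {..<i}"]) (auto simp: D_def)
  have "{} \<in> D i" for i
    by (auto simp: D_def)
  then have ne: "card ` D i \<noteq> {}" for i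
    by blast
  have attained: "\<exists>S\<in>D i. card S = c i" for i
    using Max_in[OF finite_imageI[OF fin] ne, of i] unfolding c_def by auto
  have finS: "finite S" if "S \<in> D i" for S i
    using that finite_subset[of S "{..<i}"] by (auto simp: D_def)
  have "c i < n" if "i < N" for i
  proof (rule ccontr)
    assume "\<not> c i < n"
    then obtain S where S: "S \<in> D i" "n \<le> card S"
      using attained[of i] by auto
    then obtain T where T: "T \<subseteq> S" "card T = n"
      by (meson obtain_subset_with_card_n)
    have "i \<notin> T" "finite T"
      using S T finS[OF S(1)] finite_subset by (auto simp: D_def)
    then have "card (insert i T) = Suc n"
      using T by simp
    moreover have "insert i T \<subseteq> {..<N}"
      using S(1) T(1) \<open>i < N\<close> by (auto simp: D_def)
    moreover have "\<forall>a\<in>insert i T. \<forall>b\<in>insert i T. a < b \<longrightarrow> \<sigma> b < \<sigma> a"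
    proof (intro ballI impI)
      fix a b assume ab: "a \<in> insert i T" "b \<in> insert i T" "a < b"
      then have "b \<in> insert i S"
        using T(1) by blast
      then have "b \<le> i"
        using S(1) by (auto simp: D_def)
      then have "a \<in> S"
        using ab T(1) by auto
      with \<open>b \<in> insert i S\<close> ab(3) S(1) show "\<sigma> b < \<sigma> a"
        unfolding D_def by blast
    qed
    ultimately show False
      using good unfolding has_decreasing_def by blast
  qed
  moreover have "\<sigma> i < \<sigma> j" if ij: "i < j" "j < N" "c i = c j" for i j
  proof (rule ccontr)
    assume "\<not> \<sigma> i < \<sigma> j"
    moreover have "\<sigma> i \<noteq> \<sigma> j"
      using permutes_inj[OF \<sigma>] ij(1) by (auto simp: inj_def)
    ultimately have gt: "\<sigma> j < \<sigma> i" by simp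
    obtain S where S: "S \<in> D i" "card S = c i"
      using attained by blast
    have below: "\<And>a. a \<in> S \<Longrightarrow> a < i \<and> \<sigma> i < \<sigma> a"
      using S(1) by (auto simp: D_def)
    have "insert i S \<in> D j"
      unfolding D_def
    proof (intro CollectI conjI ballI impI)
      show "insert i S \<subseteq> {..<j}"
        using below ij(1) by (auto intro: less_trans)
      fix a b assume ab: "a \<in> insert i S" "b \<in> insert j (insert i S)" "a < b"
      show "\<sigma> b < \<sigma> a"
      proof (cases "a = i")
        case True
        then have "b = j" using ab below[of b] by auto
        with True gt show ?thesis by simp
      next
        case False
        then have "a \<in> S" using ab by blast
        then have "\<sigma> i < \<sigma> a" "b \<in> S \<Longrightarrow> \<sigma> b < \<sigma> a"
          using below S(1) ab(3) by (auto simp: D_def)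
        with gt ab(2) show ?thesis by auto
      qed
    qed
    then have "card (insert i S) \<le> c j"
      unfolding c_def by (intro Max_ge finite_imageI fin imageI)
    moreover have "i \<notin> S"
      using below by blast
    ultimately show False
      using S finS[OF S(1)] ij(3) by simp
  qed
  ultimately show thesis
    using that[of c] by blast
qed

text \<open>At the first difference \<open>i\<close> the value \<open>\<tau> i\<close> occurs in
  \<open>\<sigma>\<close> at a position \<open>j\<close> of the same colour as \<open>i\<close>. An
  earlier \<open>j\<close> is impossible, since both permutations agree there; so \<open>j\<close>
  is later, and monotonicity on the colour class gives \<open>\<sigma> i < \<tau> i\<close>.\<close>

lemma colour_indicator_lex:
  assumes \<sigma>: "\<sigma> permutes {..<N}" and \<tau>: "\<tau> permutes {..<N}" and ne: "\<tau> \<noteq> \<sigma>"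
    and c: "\<And>i j. i < j \<Longrightarrow> j < N \<Longrightarrow> c i = c j \<Longrightarrow> \<sigma> i < \<sigma> j"
    and nz: "colour_indicator N (c \<circ> inv \<sigma>) c \<tau> \<noteq> (0 :: 'c::comm_ring_1)"
  shows "lex_less N \<sigma> \<tau>"
proof -
  obtain i where i: "i < N" "\<forall>j<i. \<sigma> j = \<tau> j" "\<sigma> i \<noteq> \<tau> i"
    using permutes_first_difference[OF \<sigma> \<tau>] ne by metis
  define j where "j = inv \<sigma> (\<tau> i)"
  have \<sigma>j: "\<sigma> j = \<tau> i"
    unfolding j_def by (simp add: permutes_inverses(1)[OF \<sigma>])
  have "\<tau> i < N"
    using permutes_in_image[OF \<tau>, of i] i(1) by simp
  then have "j < N"
    using permutes_in_image[OF \<sigma>, of j] \<sigma>j by simp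
  have "c j = c i"
    using nz i(1) unfolding colour_indicator_def j_def by (auto split: if_splits)
  have "\<not> j < i"
  proof
    assume "j < i"
    then have "\<tau> j = \<tau> i"
      using i(2) \<sigma>j by simp
    with \<open>j < i\<close> show False
      using permutes_inj[OF \<tau>] by (auto simp: inj_def)
  qed
  moreover have "j \<noteq> i"
    using \<sigma>j i(3) by auto
  ultimately have "\<sigma> i < \<tau> i"
    using c[of i j] \<open>j < N\<close> \<open>c j = c i\<close> \<sigma>j by simp
  with i(1,2) show ?thesis
    unfolding lex_less_def by auto
qed

inductive_set colour_span :: "nat \<Rightarrow> nat \<Rightarrow> ((nat \<Rightarrow> nat) \<Rightarrow> 'c::comm_ring_1) set" for N n where
  zero: "(\<lambda>_. 0) \<in> colour_span N n"
| step: "g \<in> colour_span N n \<Longrightarrow> c ` {..<N} \<subseteq> {..<n} \<Longrightarrow>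
    (\<lambda>\<pi>. a * colour_indicator N c c' \<pi> + g \<pi>) \<in> colour_span N n"

lemma killed_by_antisymmetrizers_diff:
  assumes "killed_by_antisymmetrizers N k f" "killed_by_antisymmetrizers N k g"
  shows "killed_by_antisymmetrizers N k (\<lambda>\<pi>. f \<pi> - a * g \<pi>)"
  using assms unfolding killed_by_antisymmetrizers_def
  by (auto simp: right_diff_distrib sum_subtractf mult.left_commute[of _ a] simp flip: sum_distrib_left)

text \<open>The indicator attached to a permutation without long decreasing subsequences is lexicographically
  triangular, so these permutations can be cleared one after the other, starting with the
  smallest.\<close>

lemma killed_by_antisymmetrizers_in_colour_span:
  fixes f :: "(nat \<Rightarrow> nat) \<Rightarrow> 'c::field_char_0"
  assumes "killed_by_antisymmetrizers N (Suc n) f"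
  shows "\<exists>g\<in>colour_span N n. \<forall>\<pi>. \<pi> permutes {..<N} \<longrightarrow> f \<pi> = g \<pi>"
proof -
  define G where "G = {\<pi>. \<pi> permutes {..<N} \<and> \<not> has_decreasing N (Suc n) \<pi>}"
  have finG: "finite G"
    by (rule finite_subset[OF _ finite_permutations[of "{..<N}"]]) (auto simp: G_def)
  \<comment> \<open>Generalized to functions that vanish on \<open>G\<close> outside an upward
    closed set \<open>K\<close>. Subtracting a multiple of the indicator for a minimal
    \<open>\<sigma>\<close> of \<open>K\<close> clears \<open>\<sigma>\<close> and otherwise changes
    only values at larger permutations; those in \<open>G\<close> stay in \<open>K\<close>.\<close>
  have "\<exists>g\<in>colour_span N n. \<forall>\<pi>. \<pi> permutes {..<N} \<longrightarrow> f \<pi> = g \<pi>"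
    if "K \<subseteq> G" "\<And>\<sigma> \<tau>. \<sigma> \<in> K \<Longrightarrow> \<tau> \<in> G \<Longrightarrow> lex_less N \<sigma> \<tau> \<Longrightarrow> \<tau> \<in> K"
      "\<And>\<pi>. \<pi> \<in> G - K \<Longrightarrow> f \<pi> = 0" "killed_by_antisymmetrizers N (Suc n) f"
    for K and f :: "(nat \<Rightarrow> nat) \<Rightarrow> 'c"
    using finite_subset[OF that(1) finG] that
  proof (induction "card K" arbitrary: K f)
    case 0
    then have "f \<pi> = 0" if "\<pi> permutes {..<N}" for \<pi>
      using killed_by_antisymmetrizers_eq_0[OF 0(6) _ that] by (auto simp: G_def)
    then show ?case
      using colour_span.zero by (intro bexI[of _ "\<lambda>_. 0"]) auto
  next
    case (Suc m)
    then have "K \<noteq> {}" by auto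
    then obtain \<sigma> where \<sigma>: "\<sigma> \<in> K" "\<And>\<tau>. \<tau> \<in> K \<Longrightarrow> \<not> lex_less N \<tau> \<sigma>"
      using wfp_lex_less[of N] unfolding wfp_iff_ex_minimal by (metis)
    have \<sigma>G: "\<sigma> permutes {..<N}" "\<not> has_decreasing N (Suc n) \<sigma>"
      using \<sigma>(1) Suc.prems(2) by (auto simp: G_def)
    obtain c where c: "c ` {..<N} \<subseteq> {..<n}"
      "\<And>i j. i < j \<Longrightarrow> j < N \<Longrightarrow> c i = c j \<Longrightarrow> \<sigma> i < \<sigma> j"
      using no_decreasing_colouring[OF \<sigma>G] by blast
    have c': "(c \<circ> inv \<sigma>) ` {..<N} \<subseteq> {..<n}"
      using c(1) permutes_image[OF permutes_inv[OF \<sigma>G(1)]] by (metis image_comp)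
    \<comment> \<open>Transporting the colouring of positions along \<open>\<sigma>\<close> to the
      values makes the indicator 1 at \<open>\<sigma>\<close>.\<close>
    define d where "d = (colour_indicator N (c \<circ> inv \<sigma>) c :: _ \<Rightarrow> 'c)"
    have d\<sigma>: "d \<sigma> = 1"
      by (simp add: d_def colour_indicator_def permutes_inverses(2)[OF \<sigma>G(1)])
    have dlex: "lex_less N \<sigma> \<tau>" if "\<tau> permutes {..<N}" "\<tau> \<noteq> \<sigma>" "d \<tau> \<noteq> 0" for \<tau>
      using colour_indicator_lex[OF \<sigma>G(1) that(1,2) c(2)] that(3) unfolding d_def by blast
    define f' where "f' = (\<lambda>\<pi>. f \<pi> - f \<sigma> * d \<pi>)"
    have "killed_by_antisymmetrizers N (Suc n) f'"
      unfolding f'_def d_def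
      by (intro killed_by_antisymmetrizers_diff colour_indicator_killed_by_antisymmetrizers c' Suc.prems)
    moreover have "f' \<pi> = 0" if \<pi>: "\<pi> \<in> G - (K - {\<sigma>})" for \<pi>
    proof (cases "\<pi> = \<sigma>")
      case True
      then show ?thesis by (simp add: f'_def d\<sigma>)
    next
      case False
      then have "\<pi> \<in> G - K" using \<pi> by blast
      moreover from this have "d \<pi> = 0"
        using dlex[of \<pi>] False Suc.prems(3)[OF \<sigma>(1)] by (auto simp: G_def)
      ultimately show ?thesis
        using Suc.prems(4) by (simp add: f'_def)
    qed
    moreover have "\<tau> \<in> K - {\<sigma>}" if "\<rho> \<in> K - {\<sigma>}" "\<tau> \<in> G" "lex_less N \<rho> \<tau>" for \<rho> \<tau>
      using that Suc.prems(3) \<sigma>(2) by blast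
    moreover have "m = card (K - {\<sigma>})" "finite (K - {\<sigma>})" "K - {\<sigma>} \<subseteq> G"
      using Suc.hyps(2) Suc.prems(1,2) \<sigma>(1) by auto
    ultimately have "\<exists>g\<in>colour_span N n. \<forall>\<pi>. \<pi> permutes {..<N} \<longrightarrow> f' \<pi> = g \<pi>"
      by (intro Suc.hyps(1)[of "K - {\<sigma>}" f'])
    then obtain g where g: "g \<in> colour_span N n" "\<forall>\<pi>. \<pi> permutes {..<N} \<longrightarrow> f' \<pi> = g \<pi>"
      by blast
    then show ?case
      using colour_span.step[OF g(1) c', of "f \<sigma>" c]
      by (intro bexI[of _ "\<lambda>\<pi>. f \<sigma> * d \<pi> + g \<pi>"]) (auto simp: f'_def d_def algebra_simps)
  qed
  from this[of G f] assms show ?thesis by blast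
qed

text \<open>On the permutations \<open>f\<close> agrees with an element of the span of the
  indicators, and it is orthogonal to that span, hence to itself. Over an ordered field a vanishing
  sum of squares forces every value to vanish.\<close>

lemma symmetrizers_antisymmetrizers_generate:
  fixes f :: "(nat \<Rightarrow> nat) \<Rightarrow> 'c::linordered_field"
  assumes N: "n\<^sup>2 < N" and anti: "killed_by_antisymmetrizers N (Suc n) f"
    and symm: "killed_by_symmetrizers N (Suc n) f" and \<pi>: "\<pi> permutes {..<N}"
  shows "f \<pi> = 0"
proof -
  have orth: "(\<Sum>\<pi> | \<pi> permutes {..<N}. f \<pi> * g \<pi>) = 0" if "g \<in> colour_span N n" for g
    using that
  proof induction
    case (step g c a c')
    then show ?case
      using symmetrizers_orthogonal_colour_indicator[OF symm step(2) N, of c']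
      by (simp add: distrib_left sum.distrib mult.left_commute[of _ a] flip: sum_distrib_left)
  qed simp
  obtain g where g: "g \<in> colour_span N n" "\<forall>\<pi>. \<pi> permutes {..<N} \<longrightarrow> f \<pi> = g \<pi>"
    using killed_by_antisymmetrizers_in_colour_span[OF anti] by blast
  have "(\<Sum>\<pi> | \<pi> permutes {..<N}. f \<pi> * f \<pi>) = (\<Sum>\<pi> | \<pi> permutes {..<N}. f \<pi> * g \<pi>)"
    using g(2) by (intro sum.cong) auto
  also have "\<dots> = 0"
    by (rule orth[OF g(1)])
  finally have "\<forall>\<pi>\<in>{\<pi>. \<pi> permutes {..<N}}. f \<pi> * f \<pi> = 0"
    by (subst (asm) sum_nonneg_eq_0_iff) (auto simp: finite_permutations)
  then show ?thesis
    using \<pi> by simp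
qed

subsection \<open>Cyclic arrangements\<close>

lemma cycle_of_list_rotate:
  assumes "distinct (us @ vs)"
  shows "cycle_of_list (us @ vs) = cycle_of_list (vs @ us)"
  using cycle_of_list_rotate_independent[OF assms, of "length us"] by (simp add: rotate_append)

lemma cycle_of_list_next:
  assumes "distinct (us @ p # q # vs)"
  shows "cycle_of_list (us @ p # q # vs) p = q"
proof -
  have "cycle_of_list (us @ p # q # vs) = cycle_of_list (p # q # vs @ us)"
    using cycle_of_list_rotate[OF assms] by simp
  moreover have "cycle_of_list (q # vs @ us) p = p"
    using assms by (intro id_outside_supp) auto
  ultimately show ?thesis by simp
qed

lemma cycle_of_list_last:
  assumes "distinct (b # us @ [p])"
  shows "cycle_of_list (b # us @ [p]) p = b"
proof -
  have "cycle_of_list (b # us @ [p]) = cycle_of_list ([] @ p # b # us)"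
    using cycle_of_list_rotate[of "b # us" "[p]"] assms by simp
  then show ?thesis
    using cycle_of_list_next[of "[]" p b us] assms by auto
qed

text \<open>Deleting \<open>y\<close> sends \<open>p\<close> directly to the successor of
  \<open>y\<close>. Precomposing with the transposition undoes this, because the shorter cycle fixes
  \<open>y\<close>.\<close>

lemma cycle_of_list_contract:
  assumes "distinct (us @ p # y # vs)"
  shows "cycle_of_list (us @ p # y # vs) = cycle_of_list (us @ p # vs) \<circ> transpose p y"
proof -
  have *: "cycle_of_list (p # y # ws) = cycle_of_list (p # ws) \<circ> transpose p y"
    if d: "distinct (p # y # ws)" for ws
  proof (cases ws)
    case (Cons q ws')
    have "cycle_of_list [p, y] \<circ> cycle_of_list (q # ws') = cycle_of_list (q # ws') \<circ> cycle_of_list [p, y]"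
      using d Cons by (intro cycles_commute) auto
    then have "cycle_of_list (p # ws) \<circ> transpose p y =
        transpose p q \<circ> (transpose p y \<circ> cycle_of_list (q # ws'))"
      using Cons by (simp add: comp_assoc)
    moreover have "transpose p q (transpose p y x) = transpose p y (transpose y q x)" for x
      using d Cons by (auto simp: transpose_def)
    ultimately show ?thesis
      using Cons by (simp add: fun_eq_iff)
  qed simp
  show ?thesis
    using *[of "vs @ us"] assms cycle_of_list_rotate[OF assms]
      cycle_of_list_rotate[of us "p # vs"] by auto
qed

lemma cycle_of_list_no_fixed_point:
  assumes d: "distinct L" and y: "y \<in> set L" and fp: "cycle_of_list L y = y"
  shows "L = [y]"
proof -
  obtain us vs where L: "L = us @ y # vs"
    using y by (meson split_list)
  show ?thesis
  proof (cases vs)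
    case Nil
    show ?thesis
    proof (cases us)
      case (Cons b us')
      then show ?thesis using cycle_of_list_last[of b us' y] d fp Nil L by auto
    qed (simp add: L Nil)
  next
    case (Cons q vs')
    then show ?thesis using cycle_of_list_next[of us y q vs'] d fp L by auto
  qed
qed

lemma sign_cycle_of_list:
  assumes "distinct L"
  shows "sign (cycle_of_list L) = (- 1) ^ (length L - 1)"
  using assms
proof (induction L rule: cycle_of_list.induct)
  case (1 i j cs)
  then have "sign (transpose i j \<circ> cycle_of_list (j # cs)) = - sign (cycle_of_list (j # cs))"
    by (subst sign_compose) (auto simp: permutation_swap_id permutation_of_cycle sign_swap_id)
  with 1 show ?case by (simp add: comp_def)
qed simp_all

text \<open>Iterating the cycle from the common point \<open>b\<close> reads off the list letter by
  letter.\<close>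

lemma cycle_of_list_inj:
  assumes "distinct (b # xs)" "distinct (b # ys)" "set xs = set ys"
    and eq: "cycle_of_list (b # xs) = cycle_of_list (b # ys)"
  shows "xs = ys"
proof -
  have step: "k \<le> length zs \<Longrightarrow> (cycle_of_list (b # zs) ^^ k) b = (b # zs) ! k"
    if d: "distinct (b # zs)" for zs k
  proof -
    assume k: "k \<le> length zs"
    have "(map (cycle_of_list (b # zs) ^^ k) (b # zs)) ! 0 = rotate k (b # zs) ! 0"
      using cyclic_rotation[OF d] by simp
    also have "\<dots> = (b # zs) ! k"
      using k by (subst nth_rotate) auto
    finally show ?thesis by simp
  qed
  have len: "length xs = length ys"
    using assms by (metis distinct.simps(2) distinct_card)
  have "b # xs = b # ys"
    using step[OF assms(1)] step[OF assms(2)] len eq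
    by (intro nth_equalityI) (simp_all add: less_Suc_eq_le)
  then show ?thesis by simp
qed

text \<open>A list \<open>ys\<close> stands for the cyclic order \<open>b # ys\<close> of \<open>Y\<close>, cut open at \<open>b\<close>; the successors of
  the points in \<open>pred ` (Y - X)\<close> are prescribed.\<close>

definition arrangements :: "'i set \<Rightarrow> 'i \<Rightarrow> 'i set \<Rightarrow> ('i \<Rightarrow> 'i) \<Rightarrow> 'i list set" where
  "arrangements Y b X pred =
     {ys \<in> permutations_of_set (Y - {b}). \<forall>y\<in>Y - X. cycle_of_list (b # ys) (pred y) = y}"

text \<open>The condition at \<open>y\<close> becomes automatic, since \<open>L'\<close> fixes
  \<open>y\<close>; in the other conditions the transposition moves into the prescribed
  predecessors. So each contraction removes one prescribed arrow.\<close>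

lemma prescribed_contract_iff:
  assumes c: "cycle_of_list L = cycle_of_list L' \<circ> transpose p y" and y: "y \<in> Y - X" "y \<notin> set L'"
    and p: "p = pred y"
  shows "(\<forall>z\<in>Y - X. cycle_of_list L (pred z) = z) \<longleftrightarrow>
      (\<forall>z\<in>(Y - {y}) - X. cycle_of_list L' ((transpose p y \<circ> pred) z) = z)"
  using y p id_outside_supp[OF y(2)] unfolding c by auto

lemma arrangements_contract_first:
  assumes "y \<in> Y - X" "b \<in> Y" "y \<noteq> b" "pred y = b"
  shows "arrangements Y b X pred = Cons y ` arrangements (Y - {y}) b X (transpose b y \<circ> pred)"
proof (intro set_eqI iffI)
  have iff: "(\<forall>z\<in>Y - X. cycle_of_list (b # y # zs) (pred z) = z) \<longleftrightarrow>
      (\<forall>z\<in>(Y - {y}) - X. cycle_of_list (b # zs) ((transpose b y \<circ> pred) z) = z)"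
    if "distinct (b # y # zs)" for zs
    using that cycle_of_list_contract[of "[]" b y zs] assms
    by (intro prescribed_contract_iff) auto
  fix ys
  {
    assume ys: "ys \<in> arrangements Y b X pred"
    then have d: "distinct (b # ys)" "set ys = Y - {b}" and c: "cycle_of_list (b # ys) b = y"
      using assms by (auto simp: arrangements_def permutations_of_set_def)
    obtain zs where zs: "ys = y # zs"
    proof (cases ys)
      case Nil
      then show ?thesis using d(2) assms by auto
    next
      case (Cons q zs)
      then have "q = y"
        using c d(1) cycle_of_list_next[of "[]" b q zs] by (simp del: cycle_of_list.simps)
      with Cons that show ?thesis by blast
    qed
    have "zs \<in> arrangements (Y - {y}) b X (transpose b y \<circ> pred)"
      using ys iff[of zs] d assms unfolding zs arrangements_def permutations_of_set_def by auto
    then show "ys \<in> Cons y ` arrangements (Y - {y}) b X (transpose b y \<circ> pred)"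
      using zs by blast
  next
    assume "ys \<in> Cons y ` arrangements (Y - {y}) b X (transpose b y \<circ> pred)"
    then obtain zs where zs: "ys = y # zs" "zs \<in> arrangements (Y - {y}) b X (transpose b y \<circ> pred)"
      by blast
    then have "distinct (b # y # zs)" "set zs = Y - {y} - {b}"
      using assms by (auto simp: arrangements_def permutations_of_set_def)
    with zs iff[of zs] assms show "ys \<in> arrangements Y b X pred"
      unfolding arrangements_def permutations_of_set_def by auto
  }
qed

text \<open>Here the point to be deleted is the base itself. Its predecessor \<open>p\<close> must
  stand at the end of the list and becomes the new base.\<close>

lemma arrangements_contract_base:
  assumes "b \<in> Y - X" "p \<in> Y" "p \<noteq> b" "pred b = p"
  shows "arrangements Y b X pred = (\<lambda>zs. zs @ [p]) ` arrangements (Y - {b}) p X (transpose p b \<circ> pred)"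
proof (intro set_eqI iffI)
  have iff: "(\<forall>z\<in>Y - X. cycle_of_list (b # zs @ [p]) (pred z) = z) \<longleftrightarrow>
      (\<forall>z\<in>(Y - {b}) - X. cycle_of_list (p # zs) ((transpose p b \<circ> pred) z) = z)"
    if "distinct (b # zs @ [p])" for zs
    using that cycle_of_list_contract[of "[]" p b zs] cycle_of_list_rotate[of "b # zs" "[p]"] assms
    by (intro prescribed_contract_iff) auto
  fix ys
  {
    assume ys: "ys \<in> arrangements Y b X pred"
    then have d: "distinct (b # ys)" "set ys = Y - {b}" and c: "cycle_of_list (b # ys) p = b"
      using assms by (auto simp: arrangements_def permutations_of_set_def)
    have "p \<in> set ys"
      using d(2) assms by auto
    then obtain zs vs where split: "ys = zs @ p # vs"
      by (meson split_list)
    have "vs = []"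
    proof (cases vs)
      case (Cons q vs')
      then show ?thesis
        using c d(1) split cycle_of_list_next[of "b # zs" p q vs'] by auto
    qed
    with split have zs: "ys = zs @ [p]" by simp
    have "zs \<in> arrangements (Y - {b}) p X (transpose p b \<circ> pred)"
      using ys iff[of zs] d assms unfolding zs arrangements_def permutations_of_set_def by auto
    then show "ys \<in> (\<lambda>zs. zs @ [p]) ` arrangements (Y - {b}) p X (transpose p b \<circ> pred)"
      using zs by blast
  next
    assume "ys \<in> (\<lambda>zs. zs @ [p]) ` arrangements (Y - {b}) p X (transpose p b \<circ> pred)"
    then obtain zs where zs: "ys = zs @ [p]" "zs \<in> arrangements (Y - {b}) p X (transpose p b \<circ> pred)"
      by blast
    then have "distinct (b # zs @ [p])" "set zs = Y - {b} - {p}"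
      using assms by (auto simp: arrangements_def permutations_of_set_def)
    with zs iff[of zs] assms show "ys \<in> arrangements Y b X pred"
      unfolding arrangements_def permutations_of_set_def by auto
  }
qed

definition insert_after :: "'i \<Rightarrow> 'i \<Rightarrow> 'i list \<Rightarrow> 'i list" where
  "insert_after p y zs = concat (map (\<lambda>x. if x = p then [p, y] else [x]) zs)"

lemma insert_after_notin: "p \<notin> set zs \<Longrightarrow> insert_after p y zs = zs"
  by (induction zs) (auto simp: insert_after_def)

lemma insert_after_append:
  "p \<notin> set us \<Longrightarrow> p \<notin> set vs \<Longrightarrow> insert_after p y (us @ p # vs) = us @ p # y # vs"
  using insert_after_notin[of p us y] insert_after_notin[of p vs y] by (simp add: insert_after_def)

text \<open>A left inverse of the insertion, giving the injectivity needed to reindex sums.\<close>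

lemma filter_insert_after:
  "y \<notin> set zs \<Longrightarrow> y \<noteq> p \<Longrightarrow> filter (\<lambda>x. x \<noteq> y) (insert_after p y zs) = zs"
  by (induction zs) (auto simp: insert_after_def)

lemma arrangements_contract_inner:
  assumes "y \<in> Y - X" "b \<in> Y" "p \<in> Y" "y \<noteq> b" "p \<noteq> b" "p \<noteq> y" "pred y = p"
  shows "arrangements Y b X pred = insert_after p y ` arrangements (Y - {y}) b X (transpose p y \<circ> pred)"
proof (intro set_eqI iffI)
  have iff: "(\<forall>z\<in>Y - X. cycle_of_list (b # us @ p # y # vs) (pred z) = z) \<longleftrightarrow>
      (\<forall>z\<in>(Y - {y}) - X. cycle_of_list (b # us @ p # vs) ((transpose p y \<circ> pred) z) = z)"
    if "distinct (b # us @ p # y # vs)" for us vs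
    using that cycle_of_list_contract[of "b # us" p y vs] assms
    by (intro prescribed_contract_iff) auto
  fix ys
  {
    assume ys: "ys \<in> arrangements Y b X pred"
    then have d: "distinct (b # ys)" "set ys = Y - {b}" and c: "cycle_of_list (b # ys) p = y"
      using assms by (auto simp: arrangements_def permutations_of_set_def)
    have "p \<in> set ys"
      using d(2) assms by auto
    then obtain us ws where split: "ys = us @ p # ws"
      by (meson split_list)
    obtain vs where "ws = y # vs"
    proof (cases ws)
      case Nil
      then show ?thesis
        using c d(1) split cycle_of_list_last[of b us p] assms(4) by auto
    next
      case (Cons q vs)
      then show ?thesis
        using c d(1) split cycle_of_list_next[of "b # us" p q vs] that by auto
    qed
    with split have zs: "ys = us @ p # y # vs" by simp
    have "us @ p # vs \<in> arrangements (Y - {y}) b X (transpose p y \<circ> pred)"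
      using ys iff[of us vs] d assms unfolding zs arrangements_def permutations_of_set_def by auto
    moreover have "insert_after p y (us @ p # vs) = ys"
      using d(1) zs by (subst insert_after_append) auto
    ultimately show "ys \<in> insert_after p y ` arrangements (Y - {y}) b X (transpose p y \<circ> pred)"
      by blast
  next
    assume "ys \<in> insert_after p y ` arrangements (Y - {y}) b X (transpose p y \<circ> pred)"
    then obtain zs where zs: "ys = insert_after p y zs"
      "zs \<in> arrangements (Y - {y}) b X (transpose p y \<circ> pred)"
      by blast
    then have d: "distinct (b # zs)" "set zs = Y - {y} - {b}"
      using assms by (auto simp: arrangements_def permutations_of_set_def)
    then obtain us vs where split: "zs = us @ p # vs"
      using assms split_list[of p zs] by auto
    have ys: "ys = us @ p # y # vs"
      using d(1) zs(1) split insert_after_append by fastforce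
    have "y \<notin> set zs"
      using d(2) by simp
    then have "distinct (b # us @ p # y # vs)" "set (us @ p # y # vs) = Y - {b}"
      using d assms unfolding split by auto
    with zs(2) iff[of us vs] show "ys \<in> arrangements Y b X pred"
      unfolding arrangements_def permutations_of_set_def ys split by auto
  }
qed

text \<open>Left multiplication of a cycle by permutations of \<open>X\<close> redirects the arrows into \<open>X\<close> only, so it
  permutes the blocks into which \<open>X\<close> cuts the cycle. The induction merges the letters of each block
  into a single one, and the letters of the block containing \<open>b\<close> into the map \<open>h\<close>.\<close>

lemma sum_arrangements_eq_0:
  fixes a :: "'i \<Rightarrow> 'r::ring_1" and h :: "'r \<Rightarrow> 'c::ab_group_add"
  assumes symm: "\<And>U (a :: 'i \<Rightarrow> 'r). finite U \<Longrightarrow> card U = n \<Longrightarrow> a ` U \<subseteq> B \<Longrightarrow>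
      (\<Sum>l\<in>permutations_of_set U. prod_list (map a l)) = 0"
    and B: "\<And>x y. x \<in> B \<Longrightarrow> y \<in> B \<Longrightarrow> x * y \<in> B"
    and Y: "finite Y" "X \<subseteq> Y" "card X = Suc n" "b \<in> Y" "a ` Y \<subseteq> B"
    and h: "\<And>x y. h (x + y) = h x + h y"
  shows "(\<Sum>ys\<in>arrangements Y b X pred. h (prod_list (map a ys))) = 0"
  using Y h
proof (induction "card (Y - X)" arbitrary: Y b pred a h)
  case 0
  then have "Y = X"
    by auto
  have h0: "h 0 = 0"
    using 0(7)[of 0 0] by simp
  have hsum: "h (sum g S) = (\<Sum>x\<in>S. h (g x))" for g :: "'i list \<Rightarrow> 'r" and S
    by (induction S rule: infinite_finite_induct) (simp_all add: h0 0(7))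
  \<comment> \<open>Without prescribed arrows the \<open>n\<close> points other than
    \<open>b\<close> occur in every order, so the symmetrized sum vanishes by
    \<open>symm\<close>.\<close>
  have "arrangements Y b X pred = permutations_of_set (Y - {b})"
    unfolding arrangements_def \<open>Y = X\<close> by auto
  then show ?case
    using symm[of "Y - {b}" a] 0 \<open>Y = X\<close> by (simp add: hsum[symmetric] h0 image_subset_iff)
next
  case (Suc m)
  then have "Y - X \<noteq> {}" by auto
  then obtain y where y: "y \<in> Y - X" by blast
  define p where "p = pred y"
  define Y' where "Y' = Y - {y}"
  have fin: "finite (Y - X)"
    using Suc.prems by simp
  have "Y' - X = (Y - X) - {y}"
    unfolding Y'_def by blast
  then have Y': "m = card (Y' - X)" "finite Y'" "X \<subseteq> Y'"
    using Suc.hyps(2) Suc.prems y fin by (auto simp: Y'_def)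
  have XY: "card X = Suc n" by fact
  note IH = Suc.hyps(1)[OF Y' XY]
  have aY: "\<And>x. x \<in> Y \<Longrightarrow> a x \<in> B"
    using Suc.prems by auto
  consider "p \<notin> Y \<or> p = y" | "y = b" "p \<in> Y" "p \<noteq> b" | "y \<noteq> b" "p = b"
    | "y \<noteq> b" "p \<noteq> b" "p \<in> Y" "p \<noteq> y"
    by blast
  then show ?case
  proof cases
    case 1
    \<comment> \<open>A cycle through all of \<open>Y\<close> fixes points outside \<open>Y\<close>
      and has no fixed point inside, as \<open>Y\<close> contains \<open>y\<close> and the nonempty
      set \<open>X\<close>; so no cycle meets the prescription.\<close>
    have "arrangements Y b X pred = {}"
    proof (rule ccontr)
      assume "arrangements Y b X pred \<noteq> {}"
      then obtain ys where "ys \<in> arrangements Y b X pred" by blast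
      then have ys: "distinct (b # ys)" "set (b # ys) = Y" "cycle_of_list (b # ys) p = y"
        using y Suc.prems(4) by (auto simp: arrangements_def permutations_of_set_def p_def)
      then have "p = y"
        using 1 id_outside_supp[of p "b # ys"] y by auto
      then have "b # ys = [y]"
        using cycle_of_list_no_fixed_point[of "b # ys" y] ys y by auto
      then have "Y = {y}"
        using ys(2) by auto
      with Y'(3) XY show False
        by (auto simp: Y'_def)
    qed
    then show ?thesis by simp
  next
    case 2
    \<comment> \<open>The predecessor \<open>p\<close> becomes the base; its letter is the last
      factor of every product and is absorbed into \<open>h\<close>.\<close>
    have "arrangements Y b X pred = (\<lambda>zs. zs @ [p]) ` arrangements Y' p X (transpose p b \<circ> pred)"
      using arrangements_contract_base[of b Y X p pred] 2 y unfolding Y'_def p_def by blast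
    then have "(\<Sum>ys\<in>arrangements Y b X pred. h (prod_list (map a ys))) =
        (\<Sum>zs\<in>arrangements Y' p X (transpose p b \<circ> pred). h (prod_list (map a zs) * a p))"
      by (simp add: sum.reindex inj_on_def)
    also have "\<dots> = 0"
    proof (rule IH[of p a "\<lambda>x. h (x * a p)"])
      show "p \<in> Y'" "a ` Y' \<subseteq> B"
        using 2 Suc.prems(5) by (auto simp: Y'_def)
    qed (simp add: distrib_right Suc.prems(6))
    finally show ?thesis .
  next
    case 3
    have "arrangements Y b X pred = Cons y ` arrangements Y' b X (transpose b y \<circ> pred)"
      using arrangements_contract_first[of y Y X b pred] 3 y Suc.prems(4) unfolding Y'_def p_def
      by blast
    then have "(\<Sum>ys\<in>arrangements Y b X pred. h (prod_list (map a ys))) =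
        (\<Sum>zs\<in>arrangements Y' b X (transpose b y \<circ> pred). h (a y * prod_list (map a zs)))"
      by (simp add: sum.reindex)
    also have "\<dots> = 0"
    proof (rule IH[of b a "\<lambda>x. h (a y * x)"])
      show "b \<in> Y'" "a ` Y' \<subseteq> B"
        using 3 Suc.prems(4,5) by (auto simp: Y'_def)
    qed (simp add: distrib_left Suc.prems(6))
    finally show ?thesis .
  next
    case 4
    define a' where "a' = a(p := a p * a y)"
    let ?A = "arrangements Y' b X (transpose p y \<circ> pred)"
    have A: "distinct zs" "set zs = Y - {y} - {b}" if "zs \<in> ?A" for zs
      using that by (auto simp: arrangements_def permutations_of_set_def Y'_def)
    have inj: "inj_on (insert_after p y) ?A"
    proof (rule inj_on_inverseI)
      fix zs assume "zs \<in> ?A"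
      with A(2)[of zs] 4 show "filter (\<lambda>x. x \<noteq> y) (insert_after p y zs) = zs"
        by (intro filter_insert_after) auto
    qed
    have prod: "prod_list (map a (insert_after p y zs)) = prod_list (map a' zs)" if in_A: "zs \<in> ?A" for zs
    proof -
      obtain us vs where zs: "zs = us @ p # vs"
        using A(2)[OF in_A] 4 split_list[of p zs] by auto
      have "p \<notin> set us" "p \<notin> set vs"
        using A(1)[OF in_A] zs by auto
      moreover from this have "map a' us = map a us" "map a' vs = map a vs"
        by (auto simp: a'_def)
      ultimately show ?thesis
        by (simp add: zs insert_after_append mult.assoc) (simp add: a'_def mult.assoc)
    qed
    have "arrangements Y b X pred = insert_after p y ` ?A"
      using arrangements_contract_inner[of y Y X b p pred] 4 y Suc.prems(4) unfolding Y'_def p_def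
      by blast
    then have "(\<Sum>ys\<in>arrangements Y b X pred. h (prod_list (map a ys))) =
        (\<Sum>zs\<in>?A. h (prod_list (map a (insert_after p y zs))))"
      by (simp add: sum.reindex[OF inj])
    also have "\<dots> = (\<Sum>zs\<in>?A. h (prod_list (map a' zs)))"
      by (simp add: prod)
    also have "\<dots> = 0"
    proof (rule IH)
      show "b \<in> Y'"
        using 4 Suc.prems(4) by (simp add: Y'_def)
      show "a' ` Y' \<subseteq> B"
        using 4 aY B y by (auto simp: Y'_def a'_def)
    qed (rule Suc.prems)
    finally show ?thesis .
  qed
qed

subsection \<open>Unitization\<close>

primrec nat_smult :: "nat \<Rightarrow> 'a::ab_group_add \<Rightarrow> 'a" where
  "nat_smult 0 x = 0"
| "nat_smult (Suc n) x = x + nat_smult n x"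

lemma nat_smult_add_left: "nat_smult (m + n) x = nat_smult m x + nat_smult n x"
  by (induction m) (simp_all add: add.assoc)

lemma nat_smult_zero_right [simp]: "nat_smult n 0 = 0"
  by (induction n) simp_all

lemma nat_smult_add_right: "nat_smult n (x + y) = nat_smult n x + nat_smult n y"
  by (induction n) (simp_all add: algebra_simps)

lemma nat_smult_diff_right: "nat_smult n (x - y) = nat_smult n x - nat_smult n y"
  by (induction n) (simp_all add: algebra_simps)

lemma nat_smult_mult: "nat_smult (m * n) x = nat_smult m (nat_smult n x)"
  by (induction m) (simp_all add: nat_smult_add_left)

lemma nat_smult_times_left: "nat_smult n x * (y :: 'a::ring) = nat_smult n (x * y)"
  by (induction n) (simp_all add: algebra_simps)

lemma nat_smult_times_right: "x * nat_smult n (y :: 'a::ring) = nat_smult n (x * y)"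
  by (induction n) (simp_all add: algebra_simps)

definition int_smult :: "int \<Rightarrow> 'a::ab_group_add \<Rightarrow> 'a" where
  "int_smult k x = nat_smult (nat k) x - nat_smult (nat (- k)) x"

text \<open>Independence of the representation as a difference; it reduces the laws for sums and
  products of integer scalars to those for natural multiples.\<close>

lemma int_smult_int_diff: "int_smult (int m - int n) x = nat_smult m x - nat_smult n x"
proof (cases "n \<le> m")
  case True
  then show ?thesis
    using nat_smult_add_left[of "m - n" n x] by (simp add: int_smult_def nat_diff_distrib')
next
  case False
  then show ?thesis
    using nat_smult_add_left[of "n - m" m x] by (simp add: int_smult_def nat_diff_distrib')
qed

lemma int_smult_of_nat [simp]: "int_smult (int n) x = nat_smult n x"
  using int_smult_int_diff[of n 0] by simp

lemma int_smult_0 [simp]: "int_smult 0 x = 0"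
  by (simp add: int_smult_def)

lemma int_smult_zero_right [simp]: "int_smult k 0 = 0"
  by (simp add: int_smult_def)

lemma int_smult_1 [simp]: "int_smult 1 x = x"
  by (simp add: int_smult_def)

lemma int_smult_add_left: "int_smult (k + l) x = int_smult k x + int_smult l x"
proof (cases k rule: int_diff_cases, cases l rule: int_diff_cases)
  fix m n m' n' assume kl: "k = int m - int n" "l = int m' - int n'"
  then have "k + l = int (m + m') - int (n + n')" by simp
  then show ?thesis
    unfolding kl by (simp only: int_smult_int_diff nat_smult_add_left) simp
qed

lemma int_smult_add_right: "int_smult k (x + y) = int_smult k x + int_smult k y"
  by (simp add: int_smult_def nat_smult_add_right)

lemma int_smult_mult: "int_smult (k * l) x = int_smult k (int_smult l x)"
proof (cases k rule: int_diff_cases, cases l rule: int_diff_cases)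
  fix m n m' n' assume kl: "k = int m - int n" "l = int m' - int n'"
  have "k * l = int (m * m' + n * n') - int (m * n' + n * m')"
    unfolding kl by (simp add: algebra_simps)
  then show ?thesis
    unfolding kl
    by (simp only: int_smult_int_diff nat_smult_add_left nat_smult_mult nat_smult_diff_right) simp
qed

lemma int_smult_times_left: "int_smult k x * (y :: 'a::ring) = int_smult k (x * y)"
  by (simp add: int_smult_def left_diff_distrib nat_smult_times_left)

lemma int_smult_times_right: "x * int_smult k (y :: 'a::ring) = int_smult k (x * y)"
  by (simp add: int_smult_def right_diff_distrib nat_smult_times_right)

text \<open>The Dorroh extension: a unit is adjoined over the integers, so the construction depends
  only on the ring. It makes powers, empty products and \<open>prod_list\<close> available.\<close>

datatype 'a unitization = Unitization (int_part: int) (alg_part: 'a)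

instantiation unitization :: (ring) ring_1
begin

definition "0 = Unitization 0 0"
definition "1 = Unitization 1 0"
definition "x + y = Unitization (int_part x + int_part y) (alg_part x + alg_part y)"
definition "x - y = Unitization (int_part x - int_part y) (alg_part x - alg_part y)"
definition "- x = Unitization (- int_part x) (- alg_part x)"
definition "x * y = Unitization (int_part x * int_part y)
  (int_smult (int_part x) (alg_part y) + int_smult (int_part y) (alg_part x) + alg_part x * alg_part y)"

instance
  by standard
    (simp_all add: zero_unitization_def one_unitization_def plus_unitization_def
      minus_unitization_def uminus_unitization_def times_unitization_def unitization.expand
      int_smult_add_left int_smult_add_right int_smult_mult int_smult_times_left
      int_smult_times_right distrib_left distrib_right mult.commute mult.left_commute
      mult.assoc add_ac flip: int_smult_mult)

end

lemma alg_part_add [simp]: "alg_part (x + y) = alg_part x + alg_part y"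
  by (simp add: plus_unitization_def)

lemma Unitization_0_mult [simp]: "Unitization 0 x * Unitization 0 y = Unitization 0 (x * y)"
  by (simp add: times_unitization_def)

lemma Unitization_0_diff: "Unitization 0 x - Unitization 0 y = Unitization 0 (x - y)"
  by (simp add: minus_unitization_def)

lemma Unitization_0_eq_0_iff [simp]: "Unitization 0 x = 0 \<longleftrightarrow> x = 0"
  by (simp add: zero_unitization_def)

lemma Unitization_0_sum: "Unitization 0 (sum f A) = (\<Sum>x\<in>A. Unitization 0 (f x))"
proof (induction A rule: infinite_finite_induct)
  case (insert x F)
  have "Unitization 0 (f x) + Unitization 0 (sum f F) = Unitization 0 (f x + sum f F)"
    by (simp add: plus_unitization_def)
  with insert show ?case by simp
qed (simp_all add: zero_unitization_def)

lemma of_nat_mult_Unitization_0: "of_nat k * Unitization 0 x = Unitization 0 (nat_smult k x)"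
proof -
  have "of_nat k = Unitization (int k) (0 :: 'a)"
    by (induction k) (simp_all add: zero_unitization_def one_unitization_def plus_unitization_def)
  then show ?thesis
    by (simp add: times_unitization_def)
qed

text \<open>The bridge from products in the algebra to \<open>prod_list\<close>. An empty
  \<open>prod_list\<close> is the adjoined unit, which lies outside the image of the
  algebra.\<close>

lemma Unitization_0_list_mult:
  assumes "xs \<noteq> []"
  shows "Unitization 0 (list_mult xs) = prod_list (map (Unitization 0) xs)"
proof -
  have "Unitization 0 (foldl (*) x ys) = Unitization 0 x * prod_list (map (Unitization 0) ys)"
    for x :: 'a and ys
    by (induction ys arbitrary: x) (simp_all flip: Unitization_0_mult mult.assoc)
  from this[of "hd xs" "tl xs"] assms show ?thesis
    by (cases xs) (simp_all add: list_mult_def)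
qed

lemma Unitization_0_pos_power:
  assumes "n > 0"
  shows "Unitization 0 (pos_power x n) = Unitization 0 x ^ n"
  using assms Unitization_0_list_mult[of "replicate n x"] by (simp add: pos_power_def)

subsection \<open>Linearization\<close>

lemma power_sum_eq_sum_lists:
  fixes a :: "'i \<Rightarrow> 'r::ring_1"
  assumes "finite S"
  shows "(\<Sum>i\<in>S. a i) ^ n = (\<Sum>l | set l \<subseteq> S \<and> length l = n. prod_list (map a l))"
proof (induction n)
  case 0
  have "{l. set l \<subseteq> S \<and> length l = 0} = {[]}" by auto
  then show ?case by simp
next
  case (Suc n)
  have "(\<Sum>l | set l \<subseteq> S \<and> length l = Suc n. prod_list (map a l)) =
      (\<Sum>(l, i)\<in>{l. set l \<subseteq> S \<and> length l = n} \<times> S. a i * prod_list (map a l))"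
    unfolding lists_length_Suc_eq by (subst sum.reindex) (auto simp: inj_on_def intro: sum.cong)
  also have "\<dots> = (\<Sum>i\<in>S. a i) * (\<Sum>l | set l \<subseteq> S \<and> length l = n. prod_list (map a l))"
    by (simp add: sum_product sum.swap[of _ S] flip: sum.cartesian_product)
  finally show ?case using Suc by simp
qed

lemma sum_Pow_alternating:
  assumes "finite W"
  shows "(\<Sum>R\<in>Pow W. (- 1) ^ card R) = (if W = {} then 1 else (0 :: 'r::ring_1))"
proof (cases "W = {}")
  case False
  then obtain w V where W: "W = insert w V" "w \<notin> V" "finite V"
    using assms by (metis all_not_in_conv finite_insert mk_disjoint_insert)
  have disj: "Pow V \<inter> insert w ` Pow V = {}"
    using W(2) by auto
  have "(\<Sum>R\<in>insert w ` Pow V. (- 1) ^ card R) = (\<Sum>R\<in>Pow V. (- 1) ^ card (insert w R) :: 'r)"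
    using W(2) by (intro sum.reindex[unfolded comp_def]) (auto simp: inj_on_def)
  also have "\<dots> = (\<Sum>R\<in>Pow V. - ((- 1) ^ card R))"
  proof (rule sum.cong[OF refl])
    fix R assume "R \<in> Pow V"
    then have "w \<notin> R" "finite R"
      using W(2,3) finite_subset by auto
    then show "(- 1) ^ card (insert w R) = - ((- 1) ^ card R :: 'r)" by simp
  qed
  finally show ?thesis
    using False W disj by (simp add: Pow_insert sum.union_disjoint sum_negf)
qed simp

text \<open>Polarization by inclusion-exclusion: expanding the powers, a word \<open>l\<close>
  receives the alternating sum over all subsets of \<open>U - set l\<close>. This is 0 unless
  \<open>l\<close> uses every letter, and then \<open>l\<close> is a permutation because of its
  length.\<close>

lemma sum_permutations_eq_alternating_powers:
  fixes a :: "'i \<Rightarrow> 'r::ring_1"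
  assumes U: "finite U"
  shows "(\<Sum>l\<in>permutations_of_set U. prod_list (map a l)) =
    (\<Sum>R\<in>Pow U. (- 1) ^ card R * (\<Sum>i\<in>U - R. a i) ^ card U)"
proof -
  define n where "n = card U"
  let ?L = "{l. set l \<subseteq> U \<and> length l = n}"
  have finL: "finite ?L"
    using finite_lists_length_eq[OF U] .
  have "(\<Sum>R\<in>Pow U. (- 1) ^ card R * (\<Sum>i\<in>U - R. a i) ^ n) =
      (\<Sum>R\<in>Pow U. \<Sum>l\<in>?L. if set l \<subseteq> U - R then (- 1) ^ card R * prod_list (map a l) else 0)"
  proof (rule sum.cong[OF refl])
    fix R
    have "{l. set l \<subseteq> U - R \<and> length l = n} = {l\<in>?L. set l \<subseteq> U - R}" by auto
    then have "(- 1) ^ card R * (\<Sum>i\<in>U - R. a i) ^ n =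
        (\<Sum>l\<in>{l\<in>?L. set l \<subseteq> U - R}. (- 1) ^ card R * prod_list (map a l))"
      using U by (simp only: power_sum_eq_sum_lists finite_Diff sum_distrib_left)
    also have "\<dots> =
        (\<Sum>l\<in>?L. if set l \<subseteq> U - R then (- 1) ^ card R * prod_list (map a l) else 0)"
      by (rule sum.inter_filter[OF finL])
    finally show "(- 1) ^ card R * (\<Sum>i\<in>U - R. a i) ^ n =
        (\<Sum>l\<in>?L. if set l \<subseteq> U - R then (- 1) ^ card R * prod_list (map a l) else 0)" .
  qed
  also have "\<dots> = (\<Sum>l\<in>?L. (\<Sum>R\<in>Pow (U - set l). (- 1) ^ card R) * prod_list (map a l))"
  proof (subst sum.swap, rule sum.cong[OF refl])
    fix l assume "l \<in> ?L"
    then have "{R\<in>Pow U. set l \<subseteq> U - R} = Pow (U - set l)" by auto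
    moreover have "finite (Pow U)"
      using U by simp
    ultimately show "(\<Sum>R\<in>Pow U. if set l \<subseteq> U - R then (- 1) ^ card R * prod_list (map a l) else 0) =
        (\<Sum>R\<in>Pow (U - set l). (- 1) ^ card R) * prod_list (map a l)"
      by (simp only: sum_distrib_right flip: sum.inter_filter)
  qed
  also have "\<dots> = (\<Sum>l\<in>?L. if l \<in> permutations_of_set U then prod_list (map a l) else 0)"
  proof (rule sum.cong[OF refl])
    fix l assume l: "l \<in> ?L"
    then have "U - set l = {} \<longleftrightarrow> l \<in> permutations_of_set U"
      by (auto simp: permutations_of_set_def n_def intro: card_distinct)
    then show "(\<Sum>R\<in>Pow (U - set l). (- 1) ^ card R) * prod_list (map a l) =
        (if l \<in> permutations_of_set U then prod_list (map a l) else 0)"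
      using U by (simp add: sum_Pow_alternating)
  qed
  also have "\<dots> = (\<Sum>l\<in>permutations_of_set U. prod_list (map a l))"
    using finL length_finite_permutations_of_set[of _ U]
    by (subst sum.inter_filter[symmetric])
      (auto simp: n_def permutations_of_set_def intro!: sum.cong)
  finally show ?thesis unfolding n_def by simp
qed

section \<open>Subrings without unit, and linearized identities in them\<close>

definition subrng :: "'r::ring set \<Rightarrow> bool" where
  "subrng B \<longleftrightarrow> 0 \<in> B \<and> (\<forall>x\<in>B. \<forall>y\<in>B. x - y \<in> B \<and> x * y \<in> B)"

lemma diff_closed_add:
  fixes I :: "'r::ab_group_add set"
  assumes "0 \<in> I" "\<And>x y. x \<in> I \<Longrightarrow> y \<in> I \<Longrightarrow> x - y \<in> I" "x \<in> I" "y \<in> I"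
  shows "x + y \<in> I"
  using assms(2)[OF assms(3) assms(2)[OF assms(1,4)]] by simp

lemma diff_closed_sum:
  fixes I :: "'r::ab_group_add set"
  assumes "0 \<in> I" "\<And>x y. x \<in> I \<Longrightarrow> y \<in> I \<Longrightarrow> x - y \<in> I" "\<And>x. x \<in> A \<Longrightarrow> g x \<in> I"
  shows "sum g A \<in> I"
  using assms(3) by (induction A rule: infinite_finite_induct)
    (use assms(1) diff_closed_add[OF assms(1,2)] in auto)

lemma subrngD:
  assumes "subrng B"
  shows "0 \<in> B" "x \<in> B \<Longrightarrow> y \<in> B \<Longrightarrow> x - y \<in> B" "x \<in> B \<Longrightarrow> y \<in> B \<Longrightarrow> x * y \<in> B"
    "x \<in> B \<Longrightarrow> y \<in> B \<Longrightarrow> x + y \<in> B" "(\<And>x. x \<in> A \<Longrightarrow> g x \<in> B) \<Longrightarrow> sum g A \<in> B"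
proof -
  show "x \<in> B \<Longrightarrow> y \<in> B \<Longrightarrow> x + y \<in> B"
    using assms by (intro diff_closed_add) (auto simp: subrng_def)
  show "(\<And>x. x \<in> A \<Longrightarrow> g x \<in> B) \<Longrightarrow> sum g A \<in> B"
    using assms by (intro diff_closed_sum) (auto simp: subrng_def)
qed (use assms in \<open>auto simp: subrng_def\<close>)

lemma subrng_power_mult:
  fixes x :: "'r::ring_1"
  assumes B: "subrng B" and "x \<in> B" "y \<in> B"
  shows "x ^ i * y \<in> B" "y * x ^ i \<in> B"
proof -
  show "x ^ i * y \<in> B"
    using assms by (induction i) (auto simp: mult.assoc subrngD)
  show "y * x ^ i \<in> B"
    using assms by (induction i) (auto simp: power_Suc2 subrngD simp del: power_Suc simp flip: mult.assoc)
qed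

lemma subrng_power: "subrng B \<Longrightarrow> x \<in> B \<Longrightarrow> i > 0 \<Longrightarrow> (x :: 'r::ring_1) ^ i \<in> B"
  using subrng_power_mult(2)[of B x x "i - 1"] by (cases i) simp_all

lemma subrng_prod_list:
  assumes "subrng B" "set l \<subseteq> B" "l \<noteq> []"
  shows "prod_list l \<in> (B :: 'r::ring_1 set)"
  using assms(2,3)
proof (induction l)
  case (Cons x l)
  then show ?case using subrngD(3)[OF assms(1)] by (cases "l = []") auto
qed simp

text \<open>Polarization writes the linearization as a signed sum of powers of elements of
  \<open>B\<close>, and these powers lie in \<open>I\<close>.\<close>

lemma sum_permutations_in_subgroup:
  fixes a :: "'i \<Rightarrow> 'r::ring_1"
  assumes B: "subrng B" and I: "0 \<in> I" "\<And>x y. x \<in> I \<Longrightarrow> y \<in> I \<Longrightarrow> x - y \<in> I"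
    and nil: "\<And>x. x \<in> B \<Longrightarrow> x ^ card U \<in> I" and U: "finite U" "a ` U \<subseteq> B"
  shows "(\<Sum>l\<in>permutations_of_set U. prod_list (map a l)) \<in> I"
  unfolding sum_permutations_eq_alternating_powers[OF U(1)]
proof (rule diff_closed_sum[OF I])
  fix R
  have p: "(\<Sum>i\<in>U - R. a i) ^ card U \<in> I"
    using U(2) by (intro nil subrngD(5)[OF B]) auto
  have "- ((\<Sum>i\<in>U - R. a i) ^ card U) \<in> I"
    using I(2)[OF I(1) p] by simp
  with p show "(- 1) ^ card R * (\<Sum>i\<in>U - R. a i) ^ card U \<in> I"
    by (cases "even (card R)") simp_all
qed

lemma sum_permutations_first:
  fixes a :: "'i \<Rightarrow> 'r::ring_1"
  assumes "finite U" "U \<noteq> {}"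
  shows "(\<Sum>l\<in>permutations_of_set U. prod_list (map a l)) =
    (\<Sum>u\<in>U. a u * (\<Sum>l\<in>permutations_of_set (U - {u}). prod_list (map a l)))"
proof -
  have "(\<Sum>l\<in>permutations_of_set U. prod_list (map a l)) =
      (\<Sum>u\<in>U. \<Sum>l\<in>Cons u ` permutations_of_set (U - {u}). prod_list (map a l))"
    using assms by (subst permutations_of_set_nonempty) (auto intro!: sum.UNION_disjoint)
  then show ?thesis
    by (simp add: sum.reindex sum_distrib_left)
qed

text \<open>Each word with \<open>y\<close> at a given place and \<open>x\<close> elsewhere arises
  from \<open>card V\<close> factorial orders of the labels. The induction splits off the first
  letter, which is \<open>y\<close> or one of the copies of \<open>x\<close>.\<close>

lemma sum_permutations_one_distinguished:
  fixes x y :: "'r::ring_1"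
  assumes "finite V" "u \<notin> V" "a u = y" "\<And>v. v \<in> V \<Longrightarrow> a v = x"
  shows "(\<Sum>l\<in>permutations_of_set (insert u V). prod_list (map a l)) =
    of_nat (fact (card V)) * (\<Sum>i\<le>card V. x ^ i * y * x ^ (card V - i))"
  using assms
proof (induction "card V" arbitrary: V)
  case 0
  then show ?case by simp
next
  case (Suc k)
  have const: "(\<Sum>l\<in>permutations_of_set V. prod_list (map a l)) = of_nat (fact (card V)) * x ^ card V"
  proof -
    have "prod_list (map a l) = x ^ card V" if "l \<in> permutations_of_set V" for l
    proof -
      have "map a l = replicate (length l) x"
        using that Suc.prems by (intro replicate_eqI) (auto simp: permutations_of_set_def)
      then show ?thesis
        using length_finite_permutations_of_set[OF that] by simp
    qed
    then show ?thesis using Suc.prems by simp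
  qed
  have "(\<Sum>l\<in>permutations_of_set (insert u V). prod_list (map a l)) =
      y * (of_nat (fact (card V)) * x ^ card V) +
      (\<Sum>v\<in>V. a v * (\<Sum>l\<in>permutations_of_set (insert u V - {v}). prod_list (map a l)))"
    using Suc.prems by (subst sum_permutations_first) (simp_all add: const)
  also have "(\<Sum>v\<in>V. a v * (\<Sum>l\<in>permutations_of_set (insert u V - {v}). prod_list (map a l))) =
      (\<Sum>v\<in>V. x * (of_nat (fact k) * (\<Sum>i\<le>k. x ^ i * y * x ^ (k - i))))"
  proof (rule sum.cong[OF refl])
    fix v assume v: "v \<in> V"
    then have "insert u V - {v} = insert u (V - {v})" "k = card (V - {v})"
      using Suc.prems Suc.hyps(2) by auto
    then show "a v * (\<Sum>l\<in>permutations_of_set (insert u V - {v}). prod_list (map a l)) =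
        x * (of_nat (fact k) * (\<Sum>i\<le>k. x ^ i * y * x ^ (k - i)))"
      using Suc.hyps(1)[of "V - {v}"] Suc.prems v by simp
  qed
  also have "\<dots> = of_nat (card V) * (of_nat (fact k) * (x * (\<Sum>i\<le>k. x ^ i * y * x ^ (k - i))))"
    by (simp add: mult_of_nat_commute[of "fact k" x] flip: mult.assoc)
  also have "\<dots> = of_nat (fact (card V)) * (\<Sum>i\<le>k. x ^ Suc i * y * x ^ (k - i))"
    unfolding Suc.hyps(2)[symmetric] fact_Suc of_nat_mult of_nat_id
    by (simp only: sum_distrib_left mult.assoc power_Suc)
  also have "y * (of_nat (fact (card V)) * x ^ card V) = of_nat (fact (card V)) * (y * x ^ card V)"
    by (simp only: mult_of_nat_commute[of "fact (card V)" y] flip: mult.assoc)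
  finally show ?case
    unfolding Suc.hyps(2)[symmetric] sum.atMost_Suc_shift
    by (simp only: distrib_left[symmetric] power_0 mult_1_left diff_zero diff_Suc_Suc)
qed

subsection \<open>The Nagata--Higman theorem\<close>

text \<open>A two-sided ideal \<open>I\<close> of \<open>B\<close> such that the quotient has no
  \<open>k\<close>-torsion for \<open>0 < k \<le> n\<close>. Enlarging \<open>I\<close> replaces
  passing to quotient rings in the induction.\<close>

definition isolated_ideal :: "nat \<Rightarrow> 'r::ring_1 set \<Rightarrow> 'r set \<Rightarrow> bool" where
  "isolated_ideal n B I \<longleftrightarrow> I \<subseteq> B \<and> 0 \<in> I \<and> (\<forall>x\<in>I. \<forall>y\<in>I. x - y \<in> I) \<and>
     (\<forall>x\<in>I. \<forall>y\<in>B. x * y \<in> I \<and> y * x \<in> I) \<and>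
     (\<forall>x\<in>B. \<forall>k. 0 < k \<and> k \<le> n \<and> of_nat k * x \<in> I \<longrightarrow> x \<in> I)"

lemma isolated_idealD:
  assumes "isolated_ideal n B I"
  shows "x \<in> I \<Longrightarrow> x \<in> B" "0 \<in> I" "x \<in> I \<Longrightarrow> y \<in> I \<Longrightarrow> x - y \<in> I"
    "x \<in> I \<Longrightarrow> y \<in> B \<Longrightarrow> x * y \<in> I" "x \<in> I \<Longrightarrow> y \<in> B \<Longrightarrow> y * x \<in> I"
    "x \<in> B \<Longrightarrow> 0 < k \<Longrightarrow> k \<le> n \<Longrightarrow> of_nat k * x \<in> I \<Longrightarrow> x \<in> I"
    "(\<And>x. x \<in> A \<Longrightarrow> g x \<in> I) \<Longrightarrow> sum g A \<in> I"
proof -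
  show "(\<And>x. x \<in> A \<Longrightarrow> g x \<in> I) \<Longrightarrow> sum g A \<in> I"
    using assms by (intro diff_closed_sum) (auto simp: isolated_ideal_def)
qed (use assms in \<open>auto simp: isolated_ideal_def\<close>)

lemma isolated_ideal_power_mult:
  assumes "isolated_ideal n B I" "subrng B" "x \<in> I" "y \<in> B"
  shows "x * y ^ i \<in> I" "y ^ i * x \<in> I"
proof -
  show "x * y ^ i \<in> I"
    using assms by (induction i)
      (auto simp: power_Suc2 isolated_idealD(4) simp del: power_Suc simp flip: mult.assoc)
  show "y ^ i * x \<in> I"
    using assms by (induction i) (auto simp: mult.assoc isolated_idealD(5))
qed

lemma isolated_ideal_fact:
  assumes I: "isolated_ideal n B I" and B: "subrng B" and "m \<le> n" "x \<in> B" "of_nat (fact m) * x \<in> I"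
  shows "x \<in> I"
  using assms(3,5)
proof (induction m)
  case (Suc m)
  have "of_nat (fact m) * x \<in> B"
  proof -
    have "of_nat k * x \<in> B" for k
      using \<open>x \<in> B\<close> by (induction k) (auto simp: distrib_right subrngD[OF B])
    then show ?thesis .
  qed
  moreover have "of_nat (Suc m) * (of_nat (fact m) * x) \<in> I"
    using Suc.prems(2) by (simp add: mult.assoc distrib_right)
  ultimately have "of_nat (fact m) * x \<in> I"
    using isolated_idealD(6)[OF I] Suc.prems(1) by blast
  then show ?case using Suc by simp
qed simp

lemma partial_linearization:
  assumes I: "isolated_ideal (Suc m) B I" and B: "subrng B"
    and nil: "\<And>x. x \<in> B \<Longrightarrow> x ^ Suc m \<in> I" and "x \<in> B" "y \<in> B"
  shows "(\<Sum>i\<le>m. x ^ i * y * x ^ (m - i)) \<in> I"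
proof -
  \<comment> \<open>The label \<open>m\<close> carries \<open>y\<close> and the \<open>m\<close>
    smaller labels carry \<open>x\<close>; the resulting factor \<open>fact m\<close> is cancelled
    because \<open>I\<close> is isolated.\<close>
  define a where "a = (\<lambda>i::nat. if i = m then y else x)"
  have "(\<Sum>l\<in>permutations_of_set (insert m {..<m}). prod_list (map a l)) \<in> I"
    using assms by (intro sum_permutations_in_subgroup[OF B] isolated_idealD(2,3)[OF I])
      (auto simp: a_def)
  also have "(\<Sum>l\<in>permutations_of_set (insert m {..<m}). prod_list (map a l)) =
      of_nat (fact m) * (\<Sum>i\<le>m. x ^ i * y * x ^ (m - i))"
    using sum_permutations_one_distinguished[of "{..<m}" m a y x] by (simp add: a_def)
  finally have "of_nat (fact m) * (\<Sum>i\<le>m. x ^ i * y * x ^ (m - i)) \<in> I" .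
  moreover have "(\<Sum>i\<le>m. x ^ i * y * x ^ (m - i)) \<in> B"
    using assms by (intro subrngD(5)[OF B] subrng_power_mult[OF B])
  ultimately show ?thesis
    using isolated_ideal_fact[OF I B, of m] by simp
qed

text \<open>Higgins' computation: summing the linearized identities
  \<open>\<Sum>\<^sub>i x\<^sup>i (z y\<^sup>j) x\<^bsup>m - i\<^esup>\<close>, multiplied by \<open>y\<^bsup>m - j\<^esup>\<close>, over \<open>j\<close> leaves only the terms with \<open>i = m\<close>.\<close>

lemma power_sandwich_in_ideal:
  fixes x y z :: "'r::ring_1"
  assumes I: "isolated_ideal (Suc m) B I" and B: "subrng B"
    and nil: "\<And>x. x \<in> B \<Longrightarrow> x ^ Suc m \<in> I" and xyz: "x \<in> B" "y \<in> B" "z \<in> B" and m: "m > 0"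
  shows "x ^ m * z * y ^ m \<in> I"
proof -
  define F where "F = (\<lambda>x y :: 'r. \<Sum>i\<le>m. x ^ i * y * x ^ (m - i))"
  have F: "F x y \<in> I" if "x \<in> B" "y \<in> B" for x y
    unfolding F_def using partial_linearization[OF I B nil that] .
  have "(\<Sum>j\<le>m. F x (z * y ^ j) * y ^ (m - j)) \<in> I"
    using xyz by (intro isolated_idealD(7)[OF I] isolated_ideal_power_mult[OF I B] F
        subrng_power_mult[OF B])
  moreover have "(\<Sum>j\<le>m. F x (z * y ^ j) * y ^ (m - j)) = (\<Sum>i\<le>m. x ^ i * (z * F y (x ^ (m - i))))"
    unfolding F_def sum_distrib_right sum_distrib_left
    by (subst sum.swap) (simp add: mult.assoc)
  \<comment> \<open>For \<open>i < m\<close> the inner sum is a linearized identity at the positive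
    power \<open>x ^ (m - i)\<close> in \<open>B\<close>, so the term lies in \<open>I\<close>. For
    \<open>i = m\<close> that power is 1, possibly outside \<open>B\<close>, and the inner sum is
    \<open>Suc m\<close> times \<open>y ^ m\<close>.\<close>
  moreover have "\<dots> = (\<Sum>i<m. x ^ i * (z * F y (x ^ (m - i)))) + x ^ m * (z * F y 1)"
    by (simp flip: lessThan_Suc_atMost)
  moreover have "(\<Sum>i<m. x ^ i * (z * F y (x ^ (m - i)))) \<in> I"
    using xyz by (intro isolated_idealD(7)[OF I] isolated_ideal_power_mult[OF I B]
        isolated_idealD(5)[OF I] F subrng_power[OF B]) auto
  ultimately have "x ^ m * (z * F y 1) \<in> I"
    by (metis add_diff_cancel_left' isolated_idealD(3)[OF I])
  moreover have "F y 1 = of_nat (Suc m) * y ^ m"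
    by (simp add: F_def flip: power_add)
  ultimately have "of_nat (Suc m) * (x ^ m * z * y ^ m) \<in> I"
    by (simp only: mult_of_nat_commute[of "Suc m"] mult.assoc)
  moreover have "x ^ m * z * y ^ m \<in> B"
    using xyz by (intro subrng_power_mult[OF B])
  ultimately show ?thesis
    using isolated_idealD(6)[OF I] by blast
qed

text \<open>In the step from \<open>m\<close>, the sandwich identity puts all \<open>m\<close>-th
  powers into the isolated ideal \<open>K\<close>, so \<open>K\<close> contains all products of
  length \<open>q\<close>. Hence \<open>K'\<close> contains all \<open>m\<close>-th powers, and
  therefore also all products of length \<open>q\<close>. A product of length
  \<open>q + 1 + q\<close> then lies in \<open>I\<close>.\<close>

theorem nagata_higman_ideal:
  assumes "n > 0" and B: "subrng B" and "isolated_ideal n B I" and "\<And>x. x \<in> B \<Longrightarrow> x ^ n \<in> I"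
    and "length l = 2 ^ n - 1" "set l \<subseteq> B"
  shows "prod_list l \<in> I"
  using assms(1,3-)
proof (induction n arbitrary: I l rule: nat_induct_non_zero)
  case 1
  then obtain b where "l = [b]"
    by (auto simp: length_Suc_conv)
  with 1 show ?case by force
next
  case (Suc m)
  note I = Suc.prems(1)
  define q :: nat where "q = 2 ^ m - 1"
  have "q > 0"
    using one_less_power[of "2::nat" m] Suc.hyps by (simp add: q_def)
  define K where "K = {x\<in>B. \<forall>z\<in>B. \<forall>y\<in>B. x * z * y ^ m \<in> I}"
  have "isolated_ideal m B K"
    unfolding isolated_ideal_def
  proof (intro conjI ballI allI impI)
    show "0 \<in> K"
      using isolated_idealD(2)[OF I] subrngD(1)[OF B] by (simp add: K_def)
    fix x y assume x: "x \<in> K"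
    show "x - y \<in> K" if "y \<in> K"
      using x that isolated_idealD(3)[OF I] subrngD(2)[OF B] by (auto simp: K_def left_diff_distrib)
    assume y: "y \<in> B"
    have "x * y * z * w ^ m \<in> I" if "z \<in> B" "w \<in> B" for z w
    proof -
      have "y * z \<in> B" using subrngD(3)[OF B] that y by blast
      then have "x * (y * z) * w ^ m \<in> I" using x that by (auto simp: K_def)
      then show ?thesis by (simp add: mult.assoc)
    qed
    then show "x * y \<in> K"
      using x y subrngD(3)[OF B] by (auto simp: K_def)
    show "y * x \<in> K"
      using x y subrngD(3)[OF B] isolated_idealD(5)[OF I] by (auto simp: K_def mult.assoc)
  next
    fix x k assume x: "x \<in> B" and k: "0 < k \<and> k \<le> m \<and> of_nat k * x \<in> K"
    have "x * z * y ^ m \<in> I" if "y \<in> B" "z \<in> B" for y z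
    proof (rule isolated_idealD(6)[OF I, of _ k])
      show "x * z * y ^ m \<in> B"
        using x that by (intro subrng_power_mult[OF B] subrngD(3)[OF B])
    qed (use k that in \<open>auto simp: K_def mult.assoc\<close>)
    with x show "x \<in> K" by (simp add: K_def)
  qed (auto simp: K_def)
  moreover have "x ^ m \<in> K" if "x \<in> B" for x
    unfolding K_def
    using that power_sandwich_in_ideal[OF I B Suc.prems(2)] Suc.hyps subrng_power[OF B] by blast
  ultimately have left: "prod_list l \<in> K" if "length l = q" "set l \<subseteq> B" for l
    using Suc.IH that unfolding q_def by blast
  define K' where "K' = {y\<in>B. \<forall>l z. length l = q \<and> set l \<subseteq> B \<and> z \<in> B \<longrightarrow> prod_list l * z * y \<in> I}"
  have "isolated_ideal m B K'"
    unfolding isolated_ideal_def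
  proof (intro conjI ballI allI impI)
    show "0 \<in> K'"
      using isolated_idealD(2)[OF I] subrngD(1)[OF B] by (simp add: K'_def)
    fix x y assume x: "x \<in> K'"
    show "x - y \<in> K'" if "y \<in> K'"
      using x that isolated_idealD(3)[OF I] subrngD(2)[OF B] by (auto simp: K'_def right_diff_distrib)
    assume y: "y \<in> B"
    show "x * y \<in> K'"
      using x y subrngD(3)[OF B] isolated_idealD(4)[OF I]
      by (auto simp: K'_def simp flip: mult.assoc)
    have "prod_list l * z * (y * x) \<in> I" if "length l = q" "set l \<subseteq> B" "z \<in> B" for l z
    proof -
      have "z * y \<in> B" using subrngD(3)[OF B] that y by blast
      then have "prod_list l * (z * y) * x \<in> I" using x that by (auto simp: K'_def)
      then show ?thesis by (simp add: mult.assoc)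
    qed
    then show "y * x \<in> K'"
      using x y subrngD(3)[OF B] by (auto simp: K'_def)
  next
    fix x k assume x: "x \<in> B" and k: "0 < k \<and> k \<le> m \<and> of_nat k * x \<in> K'"
    have "prod_list l * z * x \<in> I" if "length l = q" "set l \<subseteq> B" "z \<in> B" for l z
    proof (rule isolated_idealD(6)[OF I, of _ k])
      show "prod_list l * z * x \<in> B"
        using x that subrng_prod_list[OF B, of l] \<open>q > 0\<close> by (intro subrngD(3)[OF B]) auto
      have "prod_list l * z * (of_nat k * x) \<in> I"
        using k that by (auto simp: K'_def)
      then show "of_nat k * (prod_list l * z * x) \<in> I"
        by (metis mult.assoc mult_of_nat_commute)
    qed (use k in auto)
    with x show "x \<in> K'" by (simp add: K'_def)
  qed (auto simp: K'_def)
  moreover have "x ^ m \<in> K'" if "x \<in> B" for x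
    using that left Suc.hyps subrng_power[OF B] unfolding K'_def K_def by blast
  ultimately have right: "prod_list l \<in> K'" if "length l = q" "set l \<subseteq> B" for l
    using Suc.IH that unfolding q_def by blast
  have len: "length l = q + Suc q"
    using Suc.prems(3) \<open>q > 0\<close> by (simp add: q_def)
  define z where "z = l ! q"
  have split: "l = take q l @ z # drop (Suc q) l"
    unfolding z_def using len by (intro id_take_nth_drop) simp
  have "z \<in> B" "set (take q l) \<subseteq> B" "set (drop (Suc q) l) \<subseteq> B"
    using Suc.prems(4) len set_take_subset[of q l] set_drop_subset[of "Suc q" l] nth_mem[of q l]
    unfolding z_def by auto
  then have "prod_list (take q l) * z * prod_list (drop (Suc q) l) \<in> I"
    using right[of "drop (Suc q) l"] len by (auto simp: K'_def)
  moreover have "prod_list l = prod_list (take q l) * z * prod_list (drop (Suc q) l)"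
    by (subst split) (simp add: mult.assoc)
  ultimately show ?case by simp
qed

subsection \<open>Razmyslov's theorem\<close>

text \<open>An additive functional with values in an ordered field makes the orthogonality argument
  applicable. The cycles have \<open>n\<^sup>2\<close> letters besides the base point 0, whence the
  choice of \<open>N\<close>.\<close>

lemma razmyslov_functional:
  fixes h :: "'r::ring_1 \<Rightarrow> 'c::linordered_field"
  assumes B: "subrng B" and nil: "\<And>x. x \<in> B \<Longrightarrow> x ^ n = 0"
    and h: "\<And>x y. h (x + y) = h x + h y" and l: "length l = n\<^sup>2" "set l \<subseteq> B"
  shows "h (prod_list l) = 0"
proof -
  define N where "N = Suc (n\<^sup>2)"
  define P where "P = permutations_of_set ({..<N} - {0})"
  \<comment> \<open>The value at the base point 0 is a filler in \<open>B\<close>: no list in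
    \<open>P\<close> contains 0.\<close>
  define a where "a = (\<lambda>i. case i of 0 \<Rightarrow> 0 | Suc j \<Rightarrow> l ! j)"
  define H where "H = (\<lambda>ys. h (prod_list (map a ys)))"
  \<comment> \<open>At most one summand is nonzero, since the cycle determines the list. The form as
    a sum allows the summations over a coset and over \<open>P\<close> to be exchanged.\<close>
  define f where "f = (\<lambda>\<pi>. \<Sum>ys\<in>P. if cycle_of_list (0 # ys) = \<pi> then H ys else 0)"
  have finP: "finite P"
    by (simp add: P_def)
  have aB: "a ` {..<N} \<subseteq> B"
    using l(1) subsetD[OF l(2) nth_mem] subrngD(1)[OF B]
    by (auto simp: a_def N_def less_Suc_eq_0_disj)
  have P: "distinct (0 # ys)" "set (0 # ys) = {..<N}" "length (0 # ys) = N" if "ys \<in> P" for ys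
    using that length_finite_permutations_of_set[of ys "{..<N} - {0}"]
    unfolding P_def permutations_of_set_def by (auto simp: N_def)
  have symm: "(\<Sum>l\<in>permutations_of_set U. prod_list (map c l)) = 0"
    if "finite U" "card U = n" "c ` U \<subseteq> B" for U and c :: "nat \<Rightarrow> 'r"
    using sum_permutations_in_subgroup[OF B, of "{0}" U c] nil that by simp
  have arr: "(\<Sum>ys\<in>arrangements {..<N} 0 X (inv \<pi>). H ys) = 0"
    if "X \<subseteq> {..<N}" "card X = Suc n" for X \<pi>
    unfolding H_def
    by (rule sum_arrangements_eq_0[OF symm subrngD(3)[OF B] _ that _ aB h]) (simp_all add: N_def)
  \<comment> \<open>A full cycle lies in the coset of \<open>\<pi>\<close> iff its composition with
    \<open>inv \<pi>\<close> fixes all points outside \<open>X\<close>, that is, iff it sends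
    \<open>inv \<pi> y\<close> to \<open>y\<close> for these \<open>y\<close>. The weight
    \<open>w\<close> treats the sums with and without signs together.\<close>
  have coset: "(\<Sum>\<tau> | \<tau> permutes X. w \<tau> * f (\<tau> \<circ> \<pi>)) =
      (\<Sum>ys\<in>arrangements {..<N} 0 X (inv \<pi>). w (cycle_of_list (0 # ys) \<circ> inv \<pi>) * H ys)"
    if X: "X \<subseteq> {..<N}" and \<pi>: "\<pi> permutes {..<N}" for X \<pi> and w :: "(nat \<Rightarrow> nat) \<Rightarrow> 'c"
  proof -
    have finX: "finite {\<tau>. \<tau> permutes X}"
      using X finite_subset finite_permutations by blast
    have solve: "cycle_of_list (0 # ys) = \<tau> \<circ> \<pi> \<longleftrightarrow> \<tau> = cycle_of_list (0 # ys) \<circ> inv \<pi>" for ys \<tau>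
    proof
      assume "cycle_of_list (0 # ys) = \<tau> \<circ> \<pi>"
      then show "\<tau> = cycle_of_list (0 # ys) \<circ> inv \<pi>"
        using permutes_inv_o(1)[OF \<pi>] by (simp add: comp_assoc)
    next
      assume "\<tau> = cycle_of_list (0 # ys) \<circ> inv \<pi>"
      then show "cycle_of_list (0 # ys) = \<tau> \<circ> \<pi>"
        using permutes_inv_o(2)[OF \<pi>] by (simp add: comp_assoc)
    qed
    have iff: "cycle_of_list (0 # ys) \<circ> inv \<pi> permutes X \<longleftrightarrow>
        (\<forall>y\<in>{..<N} - X. cycle_of_list (0 # ys) (inv \<pi> y) = y)" if "ys \<in> P" for ys
    proof -
      have "cycle_of_list (0 # ys) \<circ> inv \<pi> permutes {..<N}"
        using cycle_permutes[of "0 # ys"] P(2)[OF that] permutes_compose[OF permutes_inv[OF \<pi>]]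
        by metis
      from permutes_superset[OF this, of X] show ?thesis
        by (auto dest: permutes_not_in)
    qed
    have "(\<Sum>\<tau> | \<tau> permutes X. w \<tau> * f (\<tau> \<circ> \<pi>)) =
        (\<Sum>\<tau> | \<tau> permutes X. \<Sum>ys\<in>P. if \<tau> = cycle_of_list (0 # ys) \<circ> inv \<pi> then w \<tau> * H ys else 0)"
      unfolding f_def sum_distrib_left solve by (intro sum.cong refl) simp
    also have "\<dots> = (\<Sum>ys\<in>P. if cycle_of_list (0 # ys) \<circ> inv \<pi> permutes X
        then w (cycle_of_list (0 # ys) \<circ> inv \<pi>) * H ys else 0)"
    proof (subst sum.swap, rule sum.cong[OF refl])
      fix ys
      show "(\<Sum>\<tau> | \<tau> permutes X. if \<tau> = cycle_of_list (0 # ys) \<circ> inv \<pi> then w \<tau> * H ys else 0) =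
        (if cycle_of_list (0 # ys) \<circ> inv \<pi> permutes X
          then w (cycle_of_list (0 # ys) \<circ> inv \<pi>) * H ys else 0)"
        using sum.delta[OF finX, of "cycle_of_list (0 # ys) \<circ> inv \<pi>" "\<lambda>\<tau>. w \<tau> * H ys"] by simp
    qed
    also have "\<dots> = (\<Sum>ys\<in>P. if \<forall>y\<in>{..<N} - X. cycle_of_list (0 # ys) (inv \<pi> y) = y
        then w (cycle_of_list (0 # ys) \<circ> inv \<pi>) * H ys else 0)"
      by (intro sum.cong refl) (simp only: iff)
    also have "\<dots> = (\<Sum>ys\<in>arrangements {..<N} 0 X (inv \<pi>). w (cycle_of_list (0 # ys) \<circ> inv \<pi>) * H ys)"
      unfolding arrangements_def P_def[symmetric] by (rule sum.inter_filter[OF finP, symmetric])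
    finally show ?thesis .
  qed
  have "killed_by_symmetrizers N (Suc n) f"
    unfolding killed_by_symmetrizers_def
  proof (intro allI impI, elim conjE)
    fix X \<pi> assume X: "X \<subseteq> {..<N}" "card X = Suc n" and \<pi>: "\<pi> permutes {..<N}"
    show "(\<Sum>\<tau> | \<tau> permutes X. f (\<tau> \<circ> \<pi>)) = 0"
      using coset[OF X(1) \<pi>, of "\<lambda>_. 1"] arr[OF X] by simp
  qed
  moreover have "killed_by_antisymmetrizers N (Suc n) f"
    unfolding killed_by_antisymmetrizers_def
  proof (intro allI impI, elim conjE)
    fix X \<pi> assume X: "X \<subseteq> {..<N}" "card X = Suc n" and \<pi>: "\<pi> permutes {..<N}"
    have "permutation (inv \<pi>)"
      using permutes_inv[OF \<pi>] permutation_permutes by blast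
    \<comment> \<open>All full cycles have the same sign, so on a coset the signs contribute one
      common factor.\<close>
    then have "sign (cycle_of_list (0 # ys) \<circ> inv \<pi>) = (- 1) ^ (N - 1) * sign (inv \<pi>)"
      if "ys \<in> P" for ys
      using P[OF that] sign_cycle_of_list[of "0 # ys"]
      by (simp add: sign_compose permutation_of_cycle del: cycle_of_list.simps)
    then have "(\<Sum>ys\<in>arrangements {..<N} 0 X (inv \<pi>).
          of_int (sign (cycle_of_list (0 # ys) \<circ> inv \<pi>)) * H ys) =
        (\<Sum>ys\<in>arrangements {..<N} 0 X (inv \<pi>). of_int ((- 1) ^ (N - 1) * sign (inv \<pi>)) * H ys)"
      by (intro sum.cong refl) (simp add: arrangements_def P_def)
    also have "\<dots> = 0"
      using arr[OF X] by (simp flip: sum_distrib_left)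
    finally show "(\<Sum>\<tau> | \<tau> permutes X. of_int (sign \<tau>) * f (\<tau> \<circ> \<pi>)) = 0"
      using coset[OF X(1) \<pi>, of "\<lambda>\<tau>. of_int (sign \<tau>)"] by simp
  qed
  moreover have "n\<^sup>2 < N"
    by (simp add: N_def)
  ultimately have zero: "f \<pi> = 0" if "\<pi> permutes {..<N}" for \<pi>
    using symmetrizers_antisymmetrizers_generate that by blast
  \<comment> \<open>The increasing order gives the cycle at which \<open>f\<close> takes the value
    \<open>h (prod_list l)\<close>.\<close>
  define ys where "ys = [1..<N]"
  have ys: "ys \<in> P"
    by (auto simp: ys_def P_def permutations_of_set_def)
  have "f (cycle_of_list (0 # ys)) = (\<Sum>zs\<in>P. if zs = ys then H zs else 0)"
    unfolding f_def
  proof (intro sum.cong refl)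
    fix zs assume zs: "zs \<in> P"
    have "set zs = set ys"
      using zs ys by (auto simp: P_def permutations_of_set_def)
    then show "(if cycle_of_list (0 # zs) = cycle_of_list (0 # ys) then H zs else 0) =
        (if zs = ys then H zs else 0)"
      using cycle_of_list_inj[OF P(1)[OF zs] P(1)[OF ys]] by auto
  qed
  also have "\<dots> = H ys"
    using ys finP by simp
  also have "map a ys = l"
    unfolding ys_def N_def using l(1) by (intro nth_equalityI) (simp_all add: a_def del: upt_Suc)
  then have "H ys = h (prod_list l)"
    by (simp add: H_def)
  finally show ?thesis
    using zero[of "cycle_of_list (0 # ys)"] cycle_permutes[of "0 # ys"] P(2)[OF ys] by simp
qed

text \<open>The prime field is a copy of the rationals, so the space is also a rational vector
  space. The coordinate of \<open>v\<close> with respect to a rational basis containing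
  \<open>v\<close> is the required functional; its values lie in an ordered field.\<close>

lemma (in vector_space) rat_functional:
  assumes char: "CHAR('a) = 0" and v: "v \<noteq> 0"
  obtains \<phi> :: "'b \<Rightarrow> rat" where "\<And>x y. \<phi> (x + y) = \<phi> x + \<phi> y" "\<phi> v \<noteq> 0"
proof -
  define e :: "rat \<Rightarrow> 'a" where
    "e r = of_int (fst (quotient_of r)) / of_int (snd (quotient_of r))" for r
  have nz: "of_int k = (0 :: 'a) \<longleftrightarrow> k = 0" for k
    using of_int_eq_0_iff_char_dvd[of k, where 'a = 'a] char by simp
  \<comment> \<open>\<open>e\<close> embeds the rationals by lowest terms; any other fraction gives
    the same value.\<close>
  have e: "e (of_int a / of_int b) = of_int a / of_int b" if "b \<noteq> 0" for a b
  proof -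
    obtain c d where cd: "quotient_of (of_int a / of_int b) = (c, d)"
      by fastforce
    then have "d > 0" "of_int a / of_int b = (of_int c / of_int d :: rat)"
      using quotient_of_denom_pos quotient_of_div by blast+
    then have "of_int (a * d) = (of_int (c * b) :: rat)"
      using that by (simp add: field_simps)
    then have "a * d = c * b"
      by (simp only: of_int_eq_iff)
    then have "of_int a * of_int d = (of_int c * of_int b :: 'a)"
      by (metis of_int_mult)
    then show ?thesis
      using that \<open>d > 0\<close> cd by (simp add: e_def nz frac_eq_eq)
  qed
  have e_add: "e (r + s) = e r + e s" and e_mult: "e (r * s) = e r * e s" for r s
  proof -
    obtain a b where r: "r = of_int a / of_int b" "b \<noteq> 0"
      using quotient_of_div quotient_of_denom_pos by (metis less_irrefl surj_pair)
    obtain c d where s: "s = of_int c / of_int d" "d \<noteq> 0"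
      using quotient_of_div quotient_of_denom_pos by (metis less_irrefl surj_pair)
    have sum: "r + s = of_int (a * d + c * b) / of_int (b * d)"
      using r s by (simp add: field_simps)
    have prod: "r * s = of_int (a * c) / of_int (b * d)"
      using r s by (simp add: field_simps)
    show "e (r + s) = e r + e s"
      using r s e[of "b * d" "a * d + c * b"] by (simp add: sum[symmetric] e nz) (simp add: nz field_simps)
    show "e (r * s) = e r * e s"
      using r s e[of "b * d" "a * c"] unfolding prod by (simp add: e)
  qed
  have "e 1 = 1"
    using e[of 1 1] by simp
  interpret Q: vector_space "\<lambda>r x. scale (e r) x"
    by standard (simp_all add: scale_right_distrib scale_left_distrib e_add e_mult \<open>e 1 = 1\<close>)
  define C where "C = Q.extend_basis {v}"
  have ind: "Q.independent {v}"
    using v by simp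
  have C: "Q.independent C" "Q.span C = UNIV" "v \<in> C"
    using Q.independent_extend_basis[OF ind] Q.span_extend_basis[OF ind]
      Q.extend_basis_superset[OF ind] by (auto simp: C_def)
  show thesis
  proof (rule that[of "\<lambda>x. Q.representation C x v"])
    show "Q.representation C (x + y) v = Q.representation C x v + Q.representation C y v" for x y
      using C Q.representation_add[of C x y] Q.representation_add[of C y x] by (simp add: add.commute)
    show "Q.representation C v v \<noteq> 0"
      using C Q.representation_basis[of C v] by simp
  qed
qed

context assoc_algebra
begin

lemma scale_of_nat: "of_nat k *s x = nat_smult k x"
  by (induction k) (simp_all add: scale_left_distrib)

lemma subrng_Unitization:
  assumes "subspace C" "\<And>x y. x \<in> C \<Longrightarrow> y \<in> C \<Longrightarrow> x * y \<in> C"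
  shows "subrng (Unitization 0 ` C)"
  using assms subspace_0[of C] subspace_diff[of C]
  by (auto simp: subrng_def Unitization_0_diff image_iff zero_unitization_def)

text \<open>In the unitization, \<open>{0}\<close> is isolated in the image of \<open>C\<close>,
  because the integers from 1 to \<open>s\<close> are invertible in the field.\<close>

theorem nagata_higman:
  assumes C: "subspace C" "\<And>x y. x \<in> C \<Longrightarrow> y \<in> C \<Longrightarrow> x * y \<in> C"
    and nil: "nil_index_bound C s" and char: "CHAR('f) = 0 \<or> s < CHAR('f)"
  shows "nilpotency_bound C (2 ^ s - 1)"
proof -
  define B where "B = Unitization 0 ` C"
  have s: "s > 0"
    using nil by (simp add: nil_index_bound_def)
  have B: "subrng B"
    unfolding B_def using subrng_Unitization[OF C] .
  have torsion: "x = 0" if "0 < k" "k \<le> s" "of_nat k * Unitization 0 x = 0" for x :: 'a and k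
  proof -
    have "of_nat k *s x = 0"
      using that(3) by (simp add: of_nat_mult_Unitization_0 scale_of_nat)
    moreover have "of_nat k \<noteq> (0 :: 'f)"
      using char that(1,2) by (auto simp: of_nat_eq_0_iff_char_dvd dest: dvd_imp_le)
    ultimately show ?thesis by simp
  qed
  have ideal: "isolated_ideal s B {0}"
    using torsion subrngD(1)[OF B] by (auto simp: isolated_ideal_def B_def)
  have nil_B: "x ^ s \<in> {0}" if "x \<in> B" for x
    using that nil s by (auto simp: B_def nil_index_bound_def simp flip: Unitization_0_pos_power)
  have pos: "2 ^ s - 1 > (0 :: nat)"
    using one_less_power[of "2::nat" s] s by simp
  show ?thesis
    unfolding nilpotency_bound_def
  proof (intro conjI allI impI pos)
    fix as assume as: "length as = 2 ^ s - 1 \<and> set as \<subseteq> C"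
    then have "prod_list (map (Unitization 0) as) \<in> {0}"
      by (intro nagata_higman_ideal[OF s B ideal nil_B]) (auto simp: B_def)
    moreover have "as \<noteq> []"
      using as pos by auto
    ultimately show "list_mult as = 0"
      using Unitization_0_list_mult[of as] by simp
  qed
qed

text \<open>A nonzero product would be detected by some rational functional, which vanishes on all
  products of this length.\<close>

theorem razmyslov:
  assumes C: "subspace C" "\<And>x y. x \<in> C \<Longrightarrow> y \<in> C \<Longrightarrow> x * y \<in> C"
    and nil: "nil_index_bound C s" and char: "CHAR('f) = 0"
  shows "nilpotency_bound C (s\<^sup>2)"
proof -
  define B where "B = Unitization 0 ` C"
  have s: "s > 0"
    using nil by (simp add: nil_index_bound_def)
  have B: "subrng B"
    unfolding B_def using subrng_Unitization[OF C] .
  have nil_B: "x ^ s = 0" if "x \<in> B" for x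
    using that nil s by (auto simp: B_def nil_index_bound_def simp flip: Unitization_0_pos_power)
  show ?thesis
    unfolding nilpotency_bound_def
  proof (intro conjI allI impI)
    show "s\<^sup>2 > 0" using s by simp
    fix as assume as: "length as = s\<^sup>2 \<and> set as \<subseteq> C"
    show "list_mult as = 0"
    proof (rule ccontr)
      assume "list_mult as \<noteq> 0"
      then obtain \<phi> :: "'a \<Rightarrow> rat" where \<phi>: "\<And>x y. \<phi> (x + y) = \<phi> x + \<phi> y" "\<phi> (list_mult as) \<noteq> 0"
        using rat_functional[OF char] by metis
      have "\<phi> (alg_part (prod_list (map (Unitization 0) as))) = 0"
        using as by (intro razmyslov_functional[OF B nil_B, of "\<lambda>x. \<phi> (alg_part x)"])
          (auto simp: \<phi>(1) B_def)
      moreover have "as \<noteq> []"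
        using as s by auto
      ultimately show False
        using \<phi>(2) Unitization_0_list_mult[of as] by (metis unitization.sel(2))
    qed
  qed
qed

end

subsection \<open>Gradings\<close>

context graded_algebra
begin

lemma homogeneous_prod_list:
  assumes "list_all2 (\<lambda>x g. x \<in> \<Gamma> g) hs gs" "hs \<noteq> []"
  shows "prod_list (map (Unitization 0) hs) \<in> Unitization 0 ` \<Gamma> (prod_list gs)"
  using assms
proof (induction rule: list_all2_induct)
  case (Cons x hs g gs)
  show ?case
  proof (cases "hs = []")
    case True
    then show ?thesis using Cons by auto
  next
    case False
    then obtain y where "y \<in> \<Gamma> (prod_list gs)" "prod_list (map (Unitization 0) hs) = Unitization 0 y"
      using Cons by auto
    then show ?thesis
      using component_mult[OF Cons(1)] by auto
  qed
qed simp

text \<open>\<open>J\<close> holds the lengths of initial segments of one common degree. The segment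
  between two consecutive lengths has degree 1 by left cancellation, so \<open>q + 1\<close> lengths
  give \<open>q\<close> neutral factors; \<open>u\<close> absorbs what precedes them.\<close>

lemma neutral_blocks:
  assumes left_cancellative: "\<forall>g h t :: 's. g * h = g * t \<longrightarrow> h = t"
    and hom: "list_all2 (\<lambda>x g. x \<in> \<Gamma> g) hs gs"
    and "card J = Suc q" "J \<subseteq> {..length hs}" "\<And>j. j \<in> J \<Longrightarrow> prod_list (take j gs) = c"
  shows "\<exists>u bs. length bs = q \<and> set bs \<subseteq> \<Gamma> 1 \<and>
    prod_list (map (Unitization 0) (take (Max J) hs)) = u * prod_list (map (Unitization 0) bs)"
  using assms(3-)
proof (induction q arbitrary: J)
  case 0
  show ?case
    by (rule exI[of _ "prod_list (map (Unitization 0) (take (Max J) hs))"]) auto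
next
  case (Suc q)
  define J' where "J' = J - {Max J}"
  have fin: "finite J" and ne: "J \<noteq> {}"
    using Suc.prems(1) by (auto intro: card_ge_0_finite)
  have J': "card J' = Suc q" "finite J'"
    using Suc.prems(1) fin ne by (auto simp: J'_def)
  then have "J' \<noteq> {}"
    by auto
  define i where "i = Max J'"
  define k where "k = Max J"
  have iJ: "i \<in> J" "k \<in> J" "i \<noteq> k"
    using Max_in[OF J'(2) \<open>J' \<noteq> {}\<close>] Max_in[OF fin ne] by (auto simp: i_def k_def J'_def)
  have ik: "i < k" "k \<le> length hs"
    using Max_ge[OF fin iJ(1)] iJ Suc.prems(2) by (auto simp: k_def)
  obtain u bs where IH: "length bs = q" "set bs \<subseteq> \<Gamma> 1"
    "prod_list (map (Unitization 0) (take i hs)) = u * prod_list (map (Unitization 0) bs)"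
    using Suc.IH[of J'] J' Suc.prems(2,3) unfolding i_def J'_def by auto
  have split: "take k xs = take i xs @ drop i (take k xs)" for xs :: "'z list"
    using ik(1) by (metis append_take_drop_id less_imp_le_nat min.absorb1 take_take)
  have len: "length gs = length hs"
    using hom by (simp add: list_all2_lengthD)
  have "prod_list (take k gs) = prod_list (take i gs) * prod_list (drop i (take k gs))"
    by (subst split) simp
  then have "c * 1 = c * prod_list (drop i (take k gs))"
    using Suc.prems(3) iJ by simp
  then have one: "prod_list (drop i (take k gs)) = 1"
    using left_cancellative by metis
  have "drop i (take k hs) \<noteq> []"
    using ik by simp
  moreover have "list_all2 (\<lambda>x g. x \<in> \<Gamma> g) (drop i (take k hs)) (drop i (take k gs))"
    using hom by (intro list_all2_dropI list_all2_takeI)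
  ultimately obtain b where b: "b \<in> \<Gamma> 1"
    "prod_list (map (Unitization 0) (drop i (take k hs))) = Unitization 0 b"
    using homogeneous_prod_list one by (metis imageE)
  have "prod_list (map (Unitization 0) (take k hs)) =
      prod_list (map (Unitization 0) (take i hs)) * prod_list (map (Unitization 0) (drop i (take k hs)))"
    by (subst split) simp
  also have "\<dots> = u * prod_list (map (Unitization 0) (bs @ [b]))"
    by (simp add: IH(3) b(2) mult.assoc)
  finally show ?case
    using IH b(1) unfolding k_def by (intro exI[of _ u] exI[of _ "bs @ [b]"]) auto
qed

text \<open>Either an initial segment has a degree outside the support and vanishes, or more than
  \<open>q\<close> initial segments share a degree and \<open>q\<close> consecutive neutral blocks
  occur, whose product is 0.\<close>

lemma homogeneous_product_eq_0:
  assumes left_cancellative: "\<forall>g h t :: 's. g * h = g * t \<longrightarrow> h = t"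
    and fin: "finite (Supp \<Gamma>)" and q: "nilpotency_bound (\<Gamma> 1) q"
    and hom: "list_all2 (\<lambda>x g. x \<in> \<Gamma> g) hs gs"
    and long: "card (Supp \<Gamma>) * q < length hs + of_bool (1 \<in> Supp \<Gamma>)"
  shows "prod_list (map (Unitization 0) hs) = 0"
proof (cases "\<exists>i\<in>{1..length hs}. prod_list (take i gs) \<notin> Supp \<Gamma>")
  case True
  then obtain i where i: "1 \<le> i" "i \<le> length hs" "\<Gamma> (prod_list (take i gs)) = {0}"
    by (auto simp: Supp_def)
  have "list_all2 (\<lambda>x g. x \<in> \<Gamma> g) (take i hs) (take i gs)"
    using hom by (rule list_all2_takeI)
  moreover have "take i hs \<noteq> []"
    using i by auto
  ultimately have "prod_list (map (Unitization 0) (take i hs)) = 0"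
    using homogeneous_prod_list[of "take i hs" "take i gs"] i(3) by auto
  then have "prod_list (map (Unitization 0) (take i hs @ drop i hs)) = 0"
    by (simp only: map_append prod_list.append) simp
  then show ?thesis
    by (simp only: append_take_drop_id)
next
  case False
  \<comment> \<open>The empty initial segment has degree 1 and may be counted only if 1 is in the
    support; this accounts for the \<open>of_bool\<close> term.\<close>
  define A where "A = (if 1 \<in> Supp \<Gamma> then {0..length hs} else {1..length hs})"
  have "(\<lambda>i. prod_list (take i gs)) ` A \<subseteq> Supp \<Gamma>"
  proof
    fix g assume "g \<in> (\<lambda>i. prod_list (take i gs)) ` A"
    then obtain i where i: "i \<in> A" "g = prod_list (take i gs)" by blast
    then show "g \<in> Supp \<Gamma>"
      using False by (cases "i = 0") (auto simp: A_def split: if_splits)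
  qed
  moreover have "finite A" "card (Supp \<Gamma>) * q < card A"
    using long by (auto simp: A_def)
  ultimately obtain c where c: "q < card {i\<in>A. prod_list (take i gs) = c}"
    using pigeonhole_fibre[OF _ fin] by metis
  then obtain J where J: "J \<subseteq> {i\<in>A. prod_list (take i gs) = c}" "card J = Suc q"
    using obtain_subset_with_card_n[of "Suc q" "{i\<in>A. prod_list (take i gs) = c}"]
    by (auto simp: Suc_le_eq)
  have "J \<subseteq> {..length hs}" "\<And>j. j \<in> J \<Longrightarrow> prod_list (take j gs) = c"
    using J(1) by (auto simp: A_def split: if_splits)
  from neutral_blocks[OF left_cancellative hom J(2) this]
  obtain u bs where bs: "length bs = q" "set bs \<subseteq> \<Gamma> 1"
    "prod_list (map (Unitization 0) (take (Max J) hs)) = u * prod_list (map (Unitization 0) bs)"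
    by blast
  have "bs \<noteq> []" "list_mult bs = 0"
    using q bs(1,2) by (auto simp: nilpotency_bound_def)
  then have "prod_list (map (Unitization 0) bs) = 0"
    using Unitization_0_list_mult[of bs] by (simp add: zero_unitization_def)
  then have "prod_list (map (Unitization 0) (take (Max J) hs @ drop (Max J) hs)) = 0"
    by (simp only: map_append prod_list.append bs(3)) simp
  then show ?thesis
    by (simp only: append_take_drop_id)
qed

text \<open>By distributivity the factors are replaced one by one, from the left, by homogeneous
  components: \<open>hs\<close> is the part already decomposed and \<open>as\<close> the
  rest.\<close>

lemma nilpotency_bound_UNIV:
  assumes left_cancellative: "\<forall>g h t :: 's. g * h = g * t \<longrightarrow> h = t"
    and fin: "finite (Supp \<Gamma>)" and q: "nilpotency_bound (\<Gamma> 1) q"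
    and N: "N > 0" "card (Supp \<Gamma>) * q < N + of_bool (1 \<in> Supp \<Gamma>)"
  shows "nilpotency_bound (UNIV :: 'a set) N"
proof -
  have zero: "prod_list (map (Unitization 0) (hs @ as)) = 0"
    if "list_all2 (\<lambda>x g. x \<in> \<Gamma> g) hs gs" "length hs + length as = N" for hs gs as
    using that
  proof (induction as arbitrary: hs gs)
    case Nil
    then show ?case
      using homogeneous_product_eq_0[OF left_cancellative fin q] N(2) by simp
  next
    case (Cons a as)
    obtain x where x: "\<forall>g. x g \<in> \<Gamma> g" "a = (\<Sum>g | x g \<noteq> 0. x g)"
      using direct_sum[of a] by blast
    have "prod_list (map (Unitization 0) (hs @ a # as)) =
        (\<Sum>g | x g \<noteq> 0. prod_list (map (Unitization 0) ((hs @ [x g]) @ as)))"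
      by (subst x(2)) (simp add: Unitization_0_sum sum_distrib_left sum_distrib_right)
    also have "\<dots> = 0"
    proof (rule sum.neutral, rule ballI)
      fix g
      have "list_all2 (\<lambda>x g. x \<in> \<Gamma> g) (hs @ [x g]) (gs @ [g])"
        using Cons.prems(1) x(1) by (intro list_all2_appendI) auto
      then show "prod_list (map (Unitization 0) ((hs @ [x g]) @ as)) = 0"
        using Cons.prems(2) by (intro Cons.IH) auto
    qed
    finally show ?case .
  qed
  show ?thesis
    unfolding nilpotency_bound_def
  proof (intro conjI allI impI N(1))
    fix as :: "'a list" assume as: "length as = N \<and> set as \<subseteq> UNIV"
    then have "as \<noteq> []" using N(1) by auto
    then show "list_mult as = 0"
      using zero[of "[]" "[]" as] as Unitization_0_list_mult[of as] by simp
  qed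
qed

lemma subalgebra_neutral_component:
  "subspace (\<Gamma> 1)" "x \<in> \<Gamma> 1 \<Longrightarrow> y \<in> \<Gamma> 1 \<Longrightarrow> x * y \<in> \<Gamma> 1"
  using subspace_component component_mult[of x 1 y 1] by simp_all

end

lemma nd_le: "nilpotency_bound B n \<Longrightarrow> nilpotent_algebra B \<and> nd B \<le> n"
  by (auto simp: nilpotent_algebra_def nd_def intro: Least_le)

theorem theorem4p3:
  fixes scale :: "'f::field \<Rightarrow> 'a::ring \<Rightarrow> 'a"
    and \<Gamma> :: "'s::monoid_mult \<Rightarrow> 'a set"
    and p d :: nat
  assumes left_cancellative: "\<And>g h t :: 's. g * h = g * t \<Longrightarrow> h = t"
    and char: "CHAR('f) = p"
    and grading: "graded_algebra scale \<Gamma>"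
    and finite_support: "finite (Supp \<Gamma>)"
    and d: "d = card (Supp \<Gamma>)"
  shows "(\<forall>s. nil_bounded_index (\<Gamma> 1) \<and> s = nd_nil (\<Gamma> 1) \<and> s > 1 \<longrightarrow>
            (p = 0 \<or> p > s \<longrightarrow> nilpotent_algebra (UNIV :: 'a set)) \<and>
            (p > s \<longrightarrow> nd (UNIV :: 'a set) \<le> d * (2 ^ s - 1)) \<and>
            (p = 0 \<longrightarrow>
              nd (UNIV :: 'a set) \<le> d * (if s \<in> {2, 3, 4} then 2 ^ s - 1 else s ^ 2))) \<and>
         (nilpotent_algebra (\<Gamma> 1) \<and> nd (\<Gamma> 1) = 1 \<longrightarrow>
            nilpotent_algebra (UNIV :: 'a set) \<and> nd (UNIV :: 'a set) \<le> d + 1)"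
proof -
  interpret graded_algebra scale \<Gamma> by (fact grading)
  have "\<forall>g h t :: 's. g * h = g * t \<longrightarrow> h = t"
    using left_cancellative by blast
  note bound = nilpotency_bound_UNIV[OF this finite_support]
  have nil_case: "(p = 0 \<or> p > s \<longrightarrow> nilpotent_algebra (UNIV :: 'a set)) \<and>
      (p > s \<longrightarrow> nd (UNIV :: 'a set) \<le> d * (2 ^ s - 1)) \<and>
      (p = 0 \<longrightarrow> nd (UNIV :: 'a set) \<le> d * (if s \<in> {2, 3, 4} then 2 ^ s - 1 else s ^ 2))"
    if nil: "nil_bounded_index (\<Gamma> 1)" "s = nd_nil (\<Gamma> 1)" "s > 1" for s
  proof -
    have s: "nil_index_bound (\<Gamma> 1) s"
      using nil(1,2) LeastI_ex[of "nil_index_bound (\<Gamma> 1)"]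
      by (simp add: nil_bounded_index_def nd_nil_def)
    \<comment> \<open>A zero neutral component would have nil index 1. As 1 is in the support, the
      empty initial segment counts, and length \<open>d * q\<close> suffices.\<close>
    have supp: "1 \<in> Supp \<Gamma>"
    proof (rule ccontr)
      assume "1 \<notin> Supp \<Gamma>"
      then have "nil_index_bound (\<Gamma> 1) 1"
        by (simp add: Supp_def nil_index_bound_def pos_power_def list_mult_def)
      then have "nd_nil (\<Gamma> 1) \<le> 1"
        unfolding nd_nil_def by (rule Least_le)
      with nil show False by simp
    qed
    then have "d > 0"
      using d finite_support by (auto simp: card_gt_0_iff)
    have lift: "nilpotent_algebra (UNIV :: 'a set) \<and> nd (UNIV :: 'a set) \<le> d * q"
      if q: "nilpotency_bound (\<Gamma> 1) q" for q
    proof (rule nd_le, rule bound[OF q])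
      show "d * q > 0"
        using q \<open>d > 0\<close> by (simp add: nilpotency_bound_def)
      show "card (Supp \<Gamma>) * q < d * q + of_bool (1 \<in> Supp \<Gamma>)"
        using supp d by simp
    qed
    \<comment> \<open>In characteristic 0 both bounds are available; for \<open>s\<close> in
      \<open>{2, 3, 4}\<close> the value \<open>2 ^ s - 1\<close> is the smaller one.\<close>
    have "nilpotency_bound (\<Gamma> 1) (2 ^ s - 1)" if "p = 0 \<or> p > s"
      using nagata_higman[OF subalgebra_neutral_component s] char that by simp
    moreover have "nilpotency_bound (\<Gamma> 1) (s\<^sup>2)" if "p = 0"
      using razmyslov[OF subalgebra_neutral_component s] char that by simp
    ultimately show ?thesis
      using lift by auto
  qed
  have "nilpotent_algebra (UNIV :: 'a set) \<and> nd (UNIV :: 'a set) \<le> d + 1"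
    if "nilpotent_algebra (\<Gamma> 1)" "nd (\<Gamma> 1) = 1"
  proof (rule nd_le, rule bound)
    \<comment> \<open>Nilpotency index 1 allows \<open>q = 1\<close>, and length
      \<open>d + 1\<close> is enough whether or not 1 is counted in the support.\<close>
    show "nilpotency_bound (\<Gamma> 1) 1"
      using that LeastI_ex[of "nilpotency_bound (\<Gamma> 1)"] by (simp add: nilpotent_algebra_def nd_def)
  qed (use d in simp_all)
  with nil_case show ?thesis by blast
qed

end
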